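(* Let $\Omega\subset\mathbb{R}^N$ be a bounded open set and $p\in(1,N)$. Then there exists $C=C(N,\Omega,p)>0$ such that for all $s,S\in[0,1]$ with $s\le S$ and every measurable $u:\mathbb{R}^N\to\mathbb{R}$ with $u=0$ a.e. in $\mathbb{R}^N\setminus\Omega$, $$[u]_{s,p}\le C[u]_{S,p}.$$
   Context: For $s\in(0,1)$ let $c_{N,s,p}:=\frac{s\,2^{2s-1}\Gamma\left(\frac{ps+p+N-2}{2}\right)}{\pi^{N/2}\Gamma(1-s)}$. For measurable $u$: $[u]_{0,p}:=\|u\|_{L^p(\mathbb{R}^N)}$; $[u]_{s,p}:=\left(c_{N,s,p}\iint_{\mathbb{R}^{2N}}\frac{|u(x)-u(y)|^p}{|x-y|^{N+sp}}dxdy\right)^{1/p}$ for $s\in(0,1)$; $[u]_{1,p}:=\|\nabla u\|_{L^p(\mathbb{R}^N)}$ (taken as $+\infty$ if $u$ has no weak gradient in $L^p$). *)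

theory Defs
  imports "HOL-Analysis.Analysis"
begin

coinductive C_inf :: "('a::euclidean_space \<Rightarrow> real) \<Rightarrow> bool" where
  "(\<forall>x. f differentiable (at x)) \<Longrightarrow>
   (\<forall>i\<in>Basis. C_inf (\<lambda>x. frechet_derivative f (at x) i)) \<Longrightarrow> C_inf f"

definition test_function :: "('a::euclidean_space \<Rightarrow> real) \<Rightarrow> bool" where
  "test_function \<phi> \<longleftrightarrow> C_inf \<phi> \<and> compact (closure {x. \<phi> x \<noteq> 0})"

definition weak_gradient :: "('a::euclidean_space \<Rightarrow> real) \<Rightarrow> ('a \<Rightarrow> 'a) \<Rightarrow> bool" where
  "weak_gradient u g \<longleftrightarrow>
     (\<forall>K. compact K \<longrightarrow> set_integrable lebesgue K u \<and>
                         (\<forall>i\<in>Basis. set_integrable lebesgue K (\<lambda>x. g x \<bullet> i))) \<and>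
     (\<forall>\<phi>. test_function \<phi> \<longrightarrow> (\<forall>i\<in>Basis.
        (\<integral>x. u x * frechet_derivative \<phi> (at x) i \<partial>lebesgue) = - (\<integral>x. (g x \<bullet> i) * \<phi> x \<partial>lebesgue)))"

definition enn_root :: "real \<Rightarrow> ennreal \<Rightarrow> ennreal" where
  "enn_root p I = (if I = \<infinity> then \<infinity> else ennreal (enn2real I powr (1 / p)))"

definition c_const :: "nat \<Rightarrow> real \<Rightarrow> real \<Rightarrow> real" where
  "c_const N s p = s * 2 powr (2 * s - 1) * Gamma ((p * s + p + real N - 2) / 2)
                   / (pi powr (real N / 2) * Gamma (1 - s))"

definition seminorm_sp :: "real \<Rightarrow> real \<Rightarrow> ('a::euclidean_space \<Rightarrow> real) \<Rightarrow> ennreal" where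
  "seminorm_sp s p u =
    (if s = 0 then enn_root p (\<integral>\<^sup>+ x. ennreal (\<bar>u x\<bar> powr p) \<partial>lebesgue)
     else if s < 1 then
       enn_root p (ennreal (c_const DIM('a) s p) *
         (\<integral>\<^sup>+ x. (\<integral>\<^sup>+ y. ennreal (\<bar>u x - u y\<bar> powr p / norm (x - y) powr (real DIM('a) + s * p))
            \<partial>lebesgue) \<partial>lebesgue))
     else if (\<exists>g. weak_gradient u g \<and> (\<integral>\<^sup>+ x. ennreal (norm (g x) powr p) \<partial>lebesgue) < \<infinity>)
       then enn_root p (\<integral>\<^sup>+ x. ennreal (norm ((SOME g. weak_gradient u g \<and>
              (\<integral>\<^sup>+ x. ennreal (norm (g x) powr p) \<partial>lebesgue) < \<infinity>) x) powr p) \<partial>lebesgue)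
     else \<infinity>)"

end

(*
Let w(h) be the p-th power of the L^p norm of u(. + h) - u, so that the fractional energy is
c_s times the integral of w(h) |h|^(-N - sp). Three properties of w matter: by convexity
w(2h) <= 2^p w(h); for |h| at least the diameter D of the support, w(h) = 2 |u|_p^p; and
w(h) <= |h|^p |grad u|_p^p, obtained by testing the weak gradient with bumps that approximate
indicators of boxes. The first two bound w from below near the origin by |u|_p^p. Splitting the integral over dyadic shells turns the part |h| <= D into
sum_j q^j b_j with q = 2^(-(1 - s) p), where w(2h) <= 2^p w(h) says exactly that b_j is
nondecreasing. Then (1 - q) sum_j q^j b_j is the expectation of b under a geometric distribution,
hence nondecreasing in q, that is in s, and 1 - q is comparable with 1 - s. The part |h| > D
equals |u|_p^p times a quantity comparable with 1/s. Since c_s is comparable with s (1 - s), both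
bounds are uniform in s and S.
*)

theory Submission
  imports Defs "HOL-Real_Asymp.Real_Asymp"
begin

section \<open>Smooth bump functions on boxes\<close>

text \<open>The obstacle is uniformity at both ends of the range: near the origin the integral may
  blow up like 1 / (1 - s), and the tail like 1 / s. The inner parts for s and S can be compared
  with each other. The tails cannot: after multiplication by s (1 - s) the tail is of size (1 - s)
  |u|_p^p, and for S close to 1 the corresponding quantity is much smaller. The tail for s is
  therefore charged to the whole energy for S through a Poincare inequality whose constant carries
  the full factor S (1 - S). That inequality averages two lower bounds, one from the inner part with
  factor 1 - S and one from the tail with factor S. The function u is never smoothed. The weak
  gradient enters only through its pairing with test functions, so a translation of u is moved onto
  an explicit bump, and calculus is done on the bump. All energy estimates concern an abstract
  function W with values in [0, infinity], so a function of infinite L^p norm needs no separate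
  treatment. Taking D at least 1 keeps powers such as D^(-sp) between constants that do not depend
  on s.\<close>

definition expinv :: "nat \<Rightarrow> real \<Rightarrow> real" where
  "expinv k t = (if t > 0 then exp (- 1 / t) / t ^ k else 0)"

text \<open>The index k records a negative power of t; differentiation only raises it, so the family
  is closed under derivatives up to linear combinations. At t = 0 the exponential beats every power,
  so the formula continues to hold with value 0.\<close>

lemma expinv_has_real_derivative:
  "(expinv k has_real_derivative (expinv (k + 2) t - real k * expinv (k + 1) t)) (at t)"
proof -
  consider "t > 0" | "t < 0" | "t = 0" by linarith
  then show ?thesis
  proof cases
    case 1
    have "((\<lambda>t. exp (- 1 / t) / t ^ k) has_real_derivative
            (expinv (k + 2) t - real k * expinv (k + 1) t)) (at t)"
    proof -
      \<comment> \<open>For k = 0 the truncated exponent \<open>k - Suc 0\<close> is harmless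
        because both sides vanish.\<close>
      have k: "real k * t ^ (k - Suc 0) = real k * t ^ k / t"
        using 1 by (cases k) auto
      have "((\<lambda>t. exp (- 1 / t) / t ^ k) has_real_derivative
          (exp (- 1 / t) * (1 / t ^ 2) * t ^ k - exp (- 1 / t) * (real k * t ^ (k - Suc 0))) / (t ^ k * t ^ k)) (at t)"
        using 1 by (auto intro!: derivative_eq_intros simp: power2_eq_square)
      also have "(exp (- 1 / t) * (1 / t ^ 2) * t ^ k - exp (- 1 / t) * (real k * t ^ (k - Suc 0))) / (t ^ k * t ^ k)
          = expinv (k + 2) t - real k * expinv (k + 1) t"
        unfolding k using 1 by (simp add: expinv_def field_simps power2_eq_square power_add)
      finally show ?thesis .
    qed
    then show ?thesis
      by (rule has_field_derivative_transform_within[where d = t]) (use 1 in \<open>auto simp: expinv_def dist_real_def\<close>)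
  next
    case 2
    have "((\<lambda>t. 0) has_real_derivative (expinv (k + 2) t - real k * expinv (k + 1) t)) (at t)"
      using 2 by (auto simp: expinv_def)
    then show ?thesis
      by (rule has_field_derivative_transform_within[where d = "- t"]) (use 2 in \<open>auto simp: expinv_def dist_real_def\<close>)
  next
    case 3
    have "((\<lambda>h. (expinv k h - expinv k 0) / (h - 0)) \<longlongrightarrow> 0) (at 0)"
    proof (rule filterlim_split_at)
      have "((\<lambda>h. exp (- 1 / h) / h ^ k / h) \<longlongrightarrow> 0) (at_right (0::real))"
        by real_asymp
      then show "((\<lambda>h. (expinv k h - expinv k 0) / (h - 0)) \<longlongrightarrow> 0) (at_right 0)"
        by (rule Lim_transform_eventually)
           (auto simp: expinv_def eventually_at_filter)
      show "((\<lambda>h. (expinv k h - expinv k 0) / (h - 0)) \<longlongrightarrow> 0) (at_left 0)"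
        by (rule Lim_transform_eventually[OF tendsto_const])
           (auto simp: expinv_def eventually_at_filter)
    qed
    then show ?thesis
      using 3 by (auto simp: has_field_derivative_iff expinv_def)
  qed
qed

text \<open>Closure under directional derivatives is what the coinductive \<^const>\<open>C_inf\<close> asks for.\<close>
inductive_set bump_alg :: "('a::euclidean_space \<Rightarrow> real) set" where
  const: "(\<lambda>x. c) \<in> bump_alg"
| expinv: "(\<lambda>x. expinv k (c * (x \<bullet> i) + d)) \<in> bump_alg"
| add: "f \<in> bump_alg \<Longrightarrow> g \<in> bump_alg \<Longrightarrow> (\<lambda>x. f x + g x) \<in> bump_alg"
| mult: "f \<in> bump_alg \<Longrightarrow> g \<in> bump_alg \<Longrightarrow> (\<lambda>x. f x * g x) \<in> bump_alg"

lemma bump_alg_expinv_derivative: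
  "((\<lambda>x. expinv k (c * (x \<bullet> i) + d)) has_derivative
     (\<lambda>h. (expinv (k + 2) (c * (x \<bullet> i) + d) - real k * expinv (k + 1) (c * (x \<bullet> i) + d)) * (c * (h \<bullet> i)))) (at x)"
proof -
  have "((\<lambda>x. c * (x \<bullet> i) + d) has_derivative (\<lambda>h. c * (h \<bullet> i))) (at x)"
    by (auto intro!: derivative_eq_intros)
  from has_derivative_compose[OF this
      expinv_has_real_derivative[of k "c * (x \<bullet> i) + d", unfolded has_field_derivative_def]]
  show ?thesis by simp
qed

lemma bump_alg_differentiable: "f \<in> bump_alg \<Longrightarrow> f differentiable (at x)"
proof (induction rule: bump_alg.induct)
  case (expinv k c i d)
  then show ?case using bump_alg_expinv_derivative unfolding differentiable_def by blast
qed auto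

lemma bump_alg_derivative:
  "f \<in> bump_alg \<Longrightarrow> (\<lambda>x. frechet_derivative f (at x) h) \<in> bump_alg"
proof (induction rule: bump_alg.induct)
  case (const c)
  then show ?case using bump_alg.const[of 0] by simp
next
  case (expinv k c i d)
  have "(\<lambda>x. frechet_derivative (\<lambda>x. expinv k (c * (x \<bullet> i) + d)) (at x) h) =
     (\<lambda>x. (expinv (k + 2) (c * (x \<bullet> i) + d) + (- real k) * expinv (k + 1) (c * (x \<bullet> i) + d)) * (c * (h \<bullet> i)))"
    by (subst frechet_derivative_at[OF bump_alg_expinv_derivative, symmetric]) simp
  then show ?case by (simp only:) (intro bump_alg.intros)
next
  case (add f g)
  have "frechet_derivative (\<lambda>x. f x + g x) (at x) h =
      frechet_derivative f (at x) h + frechet_derivative g (at x) h" for x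
  proof -
    note * = add(1,2)[THEN bump_alg_differentiable, THEN frechet_derivative_works[THEN iffD1], of x]
    show ?thesis
      by (subst frechet_derivative_at[OF has_derivative_add[OF *], symmetric]) simp
  qed
  with add show ?case by (auto intro!: bump_alg.intros)
next
  case (mult f g)
  have "frechet_derivative (\<lambda>x. f x * g x) (at x) h =
      f x * frechet_derivative g (at x) h + frechet_derivative f (at x) h * g x" for x
  proof -
    note * = mult(1,2)[THEN bump_alg_differentiable, THEN frechet_derivative_works[THEN iffD1], of x]
    show ?thesis
      by (subst frechet_derivative_at[OF has_derivative_mult[OF *], symmetric]) simp
  qed
  with mult show ?case by (auto intro!: bump_alg.intros)
qed

lemma bump_alg_C_inf: "f \<in> bump_alg \<Longrightarrow> C_inf f"
  by (coinduction arbitrary: f) (auto simp: bump_alg_differentiable bump_alg_derivative)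

lemma bump_alg_prod: "(\<And>i. i \<in> I \<Longrightarrow> f i \<in> bump_alg) \<Longrightarrow> (\<lambda>x. \<Prod>i\<in>I. f i x) \<in> bump_alg"
  by (induction I rule: infinite_finite_induct) (auto intro: bump_alg.intros)

lemma bump_alg_continuous: "f \<in> bump_alg \<Longrightarrow> continuous_on UNIV f"
  by (simp add: bump_alg_differentiable continuous_on_eq_continuous_within differentiable_imp_continuous_within)

text \<open>The factor \<open>Suc n\<close> leaves the support alone but pushes each exponential
  towards 1 inside the box, so the indicator of the open box becomes a pointwise limit of test
  functions from below.\<close>

definition box_bump :: "'a::euclidean_space \<Rightarrow> 'a \<Rightarrow> nat \<Rightarrow> 'a \<Rightarrow> real" where
  "box_bump a b n x = (\<Prod>i\<in>Basis. expinv 0 (real (Suc n) * ((x - a) \<bullet> i)) * expinv 0 (real (Suc n) * ((b - x) \<bullet> i)))"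

lemma box_bump_in_bump_alg: "box_bump a b n \<in> bump_alg"
proof -
  have "expinv 0 (real (Suc n) * ((x - a) \<bullet> i)) * expinv 0 (real (Suc n) * ((b - x) \<bullet> i)) =
     expinv 0 (real (Suc n) * (x \<bullet> i) + (- real (Suc n) * (a \<bullet> i))) *
     expinv 0 (- real (Suc n) * (x \<bullet> i) + real (Suc n) * (b \<bullet> i))" for x i
    by (simp add: inner_diff_left algebra_simps)
  then show ?thesis
    unfolding box_bump_def[abs_def] by (simp only:) (intro bump_alg_prod bump_alg.intros)
qed

lemma box_bump_nonneg: "0 \<le> box_bump a b n x"
  unfolding box_bump_def by (intro prod_nonneg) (simp add: expinv_def)

lemma box_bump_le_indicator: "box_bump a b n x \<le> indicator (box a b) x"
proof (cases "x \<in> box a b")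
  case True
  have "expinv 0 t * expinv 0 s \<in> {0..1}" for s t
    by (auto simp: expinv_def mult_le_one)
  with True show ?thesis
    unfolding box_bump_def by (auto intro!: prod_le_1)
next
  case False
  then obtain i where "i \<in> Basis" "\<not> (a \<bullet> i < x \<bullet> i \<and> x \<bullet> i < b \<bullet> i)"
    by (auto simp: mem_box)
  then have "(\<exists>i\<in>Basis. expinv 0 (real (Suc n) * ((x - a) \<bullet> i)) * expinv 0 (real (Suc n) * ((b - x) \<bullet> i)) = 0)"
    by (intro bexI[of _ i]) (auto simp: expinv_def inner_diff_left zero_less_mult_iff)
  then have "box_bump a b n x = 0"
    unfolding box_bump_def by (subst prod_zero_iff) auto
  with False show ?thesis by simp
qed

lemma box_bump_eq_0: "x \<notin> box a b \<Longrightarrow> box_bump a b n x = 0"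
  using box_bump_nonneg[of a b n x] box_bump_le_indicator[of a b n x] by simp

text \<open>Translating a bump stays in the family, so an identity known for all boxes may be tested
  with a translated bump.\<close>

lemma box_bump_shift: "box_bump a b n (x - c) = box_bump (a + c) (b + c) n x"
  by (simp add: box_bump_def algebra_simps)

lemma test_function_box_bump: "test_function (box_bump a b n)"
proof -
  have "closure {x. box_bump a b n x \<noteq> 0} \<subseteq> cbox a b"
    using box_bump_eq_0 box_subset_cbox by (intro closure_minimal) (blast, auto)
  then have "compact (closure {x. box_bump a b n x \<noteq> 0})"
    by (meson bounded_cbox bounded_subset closed_closure compact_eq_bounded_closed)
  then show ?thesis
    by (auto simp: test_function_def intro: bump_alg_C_inf box_bump_in_bump_alg)
qed

lemma expinv_LIMSEQ: "0 < t \<Longrightarrow> (\<lambda>n. expinv 0 (real (Suc n) * t)) \<longlonglongrightarrow> 1"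
proof -
  assume t: "0 < t"
  have "(\<lambda>n. exp (- 1 / (real (Suc n) * t))) \<longlonglongrightarrow> 1"
    using t by real_asymp
  with t show ?thesis by (simp add: expinv_def)
qed

lemma box_bump_LIMSEQ: "(\<lambda>n. box_bump a b n x) \<longlonglongrightarrow> indicator (box a b) x"
proof (cases "x \<in> box a b")
  case True
  have "(\<lambda>n. box_bump a b n x) \<longlonglongrightarrow> (\<Prod>i\<in>(Basis::'a set). 1 * 1)"
    unfolding box_bump_def
    by (intro tendsto_prod tendsto_mult expinv_LIMSEQ) (use True in \<open>auto simp: mem_box inner_diff_left\<close>)
  with True show ?thesis by simp
qed (simp add: box_bump_eq_0)

section \<open>Bumps separate locally integrable functions\<close>

text \<open>Open boxes form a generator of the Borel sets that is closed under intersection, so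
  vanishing integrals spread from boxes to all Borel sets, and then the function vanishes almost
  everywhere.\<close>

lemma AE_zero_if_box_integrals_zero:
  fixes f :: "'a::euclidean_space \<Rightarrow> real"
  assumes f: "integrable lborel f"
    and box: "\<And>a b. (LINT x:box a b|lborel. f x) = 0"
  shows "AE x in lborel. f x = 0"
proof (rule sigma_finite_measure.density_zero[OF sigma_finite_lborel f])
  have set_int: "set_integrable lborel A f" if "A \<in> sets borel" for A
    unfolding set_integrable_def using that f by (intro integrable_mult_indicator) auto
  \<comment> \<open>The whole space is no box. Its integral is a limit over growing cubes, and the
    complement case of the induction rests on it.\<close>
  have "(\<lambda>n. LINT x:box (- real n *\<^sub>R One) (real n *\<^sub>R One)|lborel. f x) \<longlonglongrightarrow> (LINT x|lborel. f x)"
    unfolding set_lebesgue_integral_def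
  proof (rule integral_dominated_convergence[where w = "\<lambda>x. norm (f x)"])
    show "AE x in lborel. (\<lambda>n. indicat_real (box (- real n *\<^sub>R One) (real n *\<^sub>R One)) x *\<^sub>R f x) \<longlonglongrightarrow> f x"
    proof (rule AE_I2)
      fix x :: 'a
      obtain n0 :: nat where n0: "norm x < real n0"
        using reals_Archimedean2 by blast
      have "x \<in> box (- real n *\<^sub>R One) (real n *\<^sub>R One)" if "n0 \<le> n" for n
      proof -
        have "\<bar>x \<bullet> i\<bar> < real n" if "i \<in> Basis" for i
          using Basis_le_norm[OF that, of x] n0 \<open>n0 \<le> n\<close> by linarith
        then show ?thesis by (auto simp: mem_box abs_less_iff) (metis minus_less_iff)
      qed
      then show "(\<lambda>n. indicat_real (box (- real n *\<^sub>R One) (real n *\<^sub>R One)) x *\<^sub>R f x) \<longlonglongrightarrow> f x"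
        by (intro tendsto_eventually eventually_sequentiallyI[of n0]) auto
    qed
  qed (use f in \<open>auto simp: indicator_def\<close>)
  then have total: "(LINT x|lborel. f x) = 0"
    by (simp add: box LIMSEQ_const_iff)
  fix A :: "'a set" assume "A \<in> sets lborel"
  have sigma_eq: "sigma_sets UNIV (range (\<lambda>(a::'a, b). box a b)) = sets borel"
    unfolding borel_eq_box by simp
  have stable: "Int_stable (range (\<lambda>(a::'a, b). box a b))"
    by (auto simp: Int_stable_def box_Int_box)
  have closed: "range (\<lambda>(a::'a, b). box a b) \<subseteq> Pow UNIV"
    by simp
  have A: "A \<in> sigma_sets UNIV (range (\<lambda>(a, b). box a b))"
    using \<open>A \<in> sets lborel\<close> by (simp add: sigma_eq)
  show "(LINT x:A|lborel. f x) = 0"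
    using stable closed A
  proof (induction rule: sigma_sets_induct_disjoint)
    case (basic A)
    then show ?case by (auto simp: box)
  next
    case empty
    then show ?case by (simp add: set_lebesgue_integral_def)
  next
    case (compl A)
    then have A: "A \<in> sets borel" by (simp only: sigma_eq)
    have "(LINT x:A \<union> (UNIV - A)|lborel. f x) = (LINT x:A|lborel. f x) + (LINT x:UNIV - A|lborel. f x)"
      using A by (intro set_integral_Un set_int) auto
    with compl(2) total show ?case by (simp add: set_lebesgue_integral_def)
  next
    case (union A)
    then have A: "A i \<in> sets borel" for i by (auto simp only: sigma_eq)
    have "(LINT x:(\<Union>i. A i)|lborel. f x) = (\<Sum>i. (LINT x:(A i)|lborel. f x))"
    proof (rule lebesgue_integral_countable_add)
      show "A i \<inter> A j = {}" if "i \<noteq> j" for i j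
        using union(1) that by (auto simp: disjoint_family_on_def)
      show "set_integrable lborel (\<Union>i. A i) f"
        using A by (intro set_int) auto
    qed (use A in simp)
    with union(3) show ?case by simp
  qed
qed

lemma box_bump_measurable [measurable]: "box_bump a b n \<in> borel_measurable borel"
  by (intro borel_measurable_continuous_onI bump_alg_continuous box_bump_in_bump_alg)

text \<open>Dominated convergence turns orthogonality to all bumps over a box into a zero integral
  over that box. This is the uniqueness principle that later identifies a difference with an
  integral of the gradient.\<close>

lemma AE_zero_if_orthogonal_to_bumps:
  fixes f :: "'a::euclidean_space \<Rightarrow> real"
  assumes f: "\<And>a b. set_integrable lborel (box a b) f"
    and orth: "\<And>a b n. (\<integral>x. f x * box_bump a b n x \<partial>lborel) = 0"
  shows "AE x in lborel. f x = 0"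
proof -
  have box: "(LINT x:box a b|lborel. f x) = 0" for a b
  proof -
    have f': "integrable lborel (\<lambda>x. indicator (box a b) x * f x)"
      using f by (simp add: set_integrable_def)
    have eq: "f x * box_bump a b n x = (indicator (box a b) x * f x) * box_bump a b n x" for x n
      by (auto simp: indicator_def box_bump_eq_0)
    have "(\<lambda>n. \<integral>x. f x * box_bump a b n x \<partial>lborel) \<longlonglongrightarrow> (\<integral>x. (indicator (box a b) x * f x) * indicator (box a b) x \<partial>lborel)"
      unfolding eq
    proof (rule integral_dominated_convergence[where w = "\<lambda>x. norm (indicator (box a b) x * f x)"])
      show "AE x in lborel. (\<lambda>n. indicator (box a b) x * f x * box_bump a b n x) \<longlonglongrightarrow> indicator (box a b) x * f x * indicator (box a b) x"
        by (intro AE_I2 tendsto_intros box_bump_LIMSEQ)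
      show "AE x in lborel. norm (indicator (box a b) x * f x * box_bump a b n x) \<le> norm (indicator (box a b) x * f x)" for n
      proof (rule AE_I2)
        fix x
        have "box_bump a b n x \<le> 1"
          using box_bump_le_indicator[of a b n x] by (simp add: indicator_def of_bool_def split: if_splits)
        then show "norm (indicator (box a b) x * f x * box_bump a b n x) \<le> norm (indicator (box a b) x * f x)"
          using box_bump_nonneg[of a b n x] by (simp add: abs_mult mult_left_le)
      qed
    qed (use f' in \<open>auto intro: borel_measurable_integrable\<close>)
    then have "(\<integral>x. (indicator (box a b) x * f x) * indicator (box a b) x \<partial>lborel) = 0"
      by (simp add: orth LIMSEQ_const_iff)
    also have "(\<lambda>x. (indicator (box a b) x * f x) * indicator (box a b) x) = (\<lambda>x. indicator (box a b) x * f x)"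
      by (auto simp: indicator_def)
    finally show ?thesis by (simp add: set_lebesgue_integral_def)
  qed
  \<comment> \<open>The function is only locally integrable, so it is cut off to cubes. A box meets
    a cube in a box, hence the cut-off functions still have zero box integrals.\<close>
  define B :: "nat \<Rightarrow> 'a set" where "B n = box (- real n *\<^sub>R One) (real n *\<^sub>R One)" for n
  have "AE x in lborel. indicator (B n) x * f x = 0" for n
  proof (rule AE_zero_if_box_integrals_zero)
    show "integrable lborel (\<lambda>x. indicator (B n) x * f x)"
      using f by (simp add: set_integrable_def B_def)
    fix a b :: 'a
    obtain c d where cd: "box a b \<inter> B n = box c d"
      unfolding B_def box_Int_box by blast
    have "(LINT x:box a b|lborel. indicator (B n) x * f x) = (LINT x:box c d|lborel. f x)"
      unfolding set_lebesgue_integral_def cd[symmetric]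
      by (intro Bochner_Integration.integral_cong) (auto simp: indicator_def)
    then show "(LINT x:box a b|lborel. indicator (B n) x * f x) = 0"
      using box by simp
  qed
  then have "AE x in lborel. \<forall>n. indicator (B n) x * f x = 0"
    by (intro AE_all_countable[THEN iffD2] allI)
  then show ?thesis
  proof eventually_elim
    case (elim x)
    obtain n :: nat where n: "norm x < real n"
      using reals_Archimedean2 by blast
    have "\<bar>x \<bullet> i\<bar> < real n" if "i \<in> Basis" for i
      using Basis_le_norm[OF that, of x] n by linarith
    then have "x \<in> B n"
      unfolding B_def by (auto simp: mem_box abs_less_iff) (metis minus_less_iff)
    with elim show ?case by (metis indicator_simps(1) mult_1)
  qed
qed

section \<open>Translation estimate for weak gradients\<close>

lemma nn_integral_lborel_shift:
  fixes c :: "'a::euclidean_space"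
  assumes [measurable]: "f \<in> borel_measurable borel"
  shows "(\<integral>\<^sup>+x. f (x + c) \<partial>lborel) = (\<integral>\<^sup>+x. f x \<partial>lborel)"
proof -
  have "(\<integral>\<^sup>+x. f x \<partial>lborel) = (\<integral>\<^sup>+x. f x \<partial>distr lborel borel ((+) c))"
    by (simp add: lborel_distr_plus)
  also have "\<dots> = (\<integral>\<^sup>+x. f (x + c) \<partial>lborel)"
    by (subst nn_integral_distr) (auto simp: add.commute)
  finally show ?thesis by simp
qed

lemma integral_lborel_shift:
  fixes c :: "'a::euclidean_space" and f :: "'a \<Rightarrow> real"
  assumes [measurable]: "f \<in> borel_measurable borel"
  shows "(\<integral>x. f (x + c) \<partial>lborel) = (\<integral>x. f x \<partial>lborel)"
proof -
  have "(\<integral>x. f x \<partial>lborel) = (\<integral>x. f x \<partial>distr lborel borel ((+) c))"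
    by (simp add: lborel_distr_plus)
  also have "\<dots> = (\<integral>x. f (x + c) \<partial>lborel)"
    by (subst integral_distr) (auto simp: add.commute)
  finally show ?thesis by simp
qed

lemma integrable_mult_bounded_compact_support:
  fixes f g :: "'a::euclidean_space \<Rightarrow> real"
  assumes f: "set_integrable lborel (cbox a b) f" and [measurable]: "f \<in> borel_measurable borel" "g \<in> borel_measurable borel"
    and bound: "\<And>x. \<bar>g x\<bar> \<le> M * indicator (cbox a b) x"
  shows "integrable lborel (\<lambda>x. f x * g x)"
proof (rule Bochner_Integration.integrable_bound)
  show "integrable lborel (\<lambda>x. M * (indicator (cbox a b) x * f x))"
    using f by (simp add: set_integrable_def)
  show "AE x in lborel. norm (f x * g x) \<le> norm (M * (indicator (cbox a b) x * f x))"
  proof (rule AE_I2)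
    fix x
    have "\<bar>f x\<bar> * \<bar>g x\<bar> \<le> \<bar>f x\<bar> * (M * indicator (cbox a b) x)"
      using bound by (intro mult_left_mono) auto
    also have "\<dots> \<le> \<bar>M * (indicator (cbox a b) x * f x)\<bar>"
      using mult_left_mono[OF abs_ge_self[of M], of "\<bar>f x\<bar>"]
      by (auto simp: indicator_def abs_mult mult.commute)
    finally show "norm (f x * g x) \<le> norm (M * (indicator (cbox a b) x * f x))"
      by (simp add: abs_mult)
  qed
qed measurable

abbreviation dir_deriv :: "('a::euclidean_space \<Rightarrow> real) \<Rightarrow> 'a \<Rightarrow> 'a \<Rightarrow> real" where
  "dir_deriv \<phi> h x \<equiv> frechet_derivative \<phi> (at x) h"

text \<open>Outside the closed box the bump vanishes on a whole neighbourhood; this is why the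
  closed box, and not the open one, appears in the support bounds.\<close>

lemma dir_deriv_box_bump_eq_0:
  assumes "x \<notin> cbox a b"
  shows "dir_deriv (box_bump a b n) h x = 0"
proof -
  have "(box_bump a b n has_derivative (\<lambda>_. 0)) (at x)"
  proof (rule has_derivative_transform_within_open)
    show "((\<lambda>_. 0) has_derivative (\<lambda>_. 0)) (at x)" by simp
    show "open (- cbox a b)" by (rule open_Compl) (rule closed_cbox)
    show "x \<in> - cbox a b" using assms by simp
    show "0 = box_bump a b n y" if "y \<in> - cbox a b" for y
      using that box_subset_cbox box_bump_eq_0[of y a b n] by fastforce
  qed
  from frechet_derivative_at[OF this] show ?thesis by metis
qed

lemma dir_deriv_box_bump_continuous: "continuous_on S (dir_deriv (box_bump a b n) h)"
  by (intro continuous_on_subset[OF bump_alg_continuous[OF bump_alg_derivative[OF box_bump_in_bump_alg]]]) auto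

lemma dir_deriv_box_bump_measurable [measurable]:
  "dir_deriv (box_bump a b n) h \<in> borel_measurable borel"
  by (intro borel_measurable_continuous_onI dir_deriv_box_bump_continuous)

lemma dir_deriv_box_bump_bounded:
  obtains M where "0 \<le> M" "\<And>x. \<bar>dir_deriv (box_bump a b n) h x\<bar> \<le> M * indicator (cbox a b) x"
proof -
  have "bounded (dir_deriv (box_bump a b n) h ` cbox a b)"
    by (intro compact_imp_bounded compact_continuous_image dir_deriv_box_bump_continuous compact_cbox)
  then obtain M where "M > 0" "\<And>x. x \<in> cbox a b \<Longrightarrow> \<bar>dir_deriv (box_bump a b n) h x\<bar> \<le> M"
    by (auto simp: bounded_pos)
  then show ?thesis
    using dir_deriv_box_bump_eq_0 by (intro that[of M]) (auto simp: indicator_def)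
qed

text \<open>The fundamental theorem of calculus along the segment from x to x - h. It is applied to
  the bump because the function under study has only a weak gradient.\<close>

lemma box_bump_FTC:
  "box_bump a b n (x - h) - box_bump a b n x =
     - (\<integral>t. dir_deriv (box_bump a b n) h (x - t *\<^sub>R h) * indicator {0..1} t \<partial>lborel)"
proof -
  let ?\<phi> = "box_bump a b n"
  have "((\<lambda>t. ?\<phi> (x - t *\<^sub>R h)) has_real_derivative - dir_deriv ?\<phi> h (x - t *\<^sub>R h)) (at t)" for t
  proof -
    have 1: "((\<lambda>t. x - t *\<^sub>R h) has_derivative (\<lambda>s. - s *\<^sub>R h)) (at t)"
      by (auto intro!: derivative_eq_intros)
    have 2: "(?\<phi> has_derivative frechet_derivative ?\<phi> (at (x - t *\<^sub>R h))) (at (x - t *\<^sub>R h))"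
      using bump_alg_differentiable[OF box_bump_in_bump_alg] frechet_derivative_works by blast
    have "linear (frechet_derivative ?\<phi> (at (x - t *\<^sub>R h)))"
      using 2 has_derivative_linear by blast
    then have eq: "(\<lambda>s. frechet_derivative ?\<phi> (at (x - t *\<^sub>R h)) (- s *\<^sub>R h)) = (*) (- dir_deriv ?\<phi> h (x - t *\<^sub>R h))"
      by (simp only: linear_scale fun_eq_iff) simp
    show ?thesis
      unfolding has_field_derivative_def eq[symmetric] by (rule has_derivative_compose[OF 1 2])
  qed
  moreover have "isCont (\<lambda>t. - dir_deriv ?\<phi> h (x - t *\<^sub>R h)) t" for t
  proof -
    have "continuous_on UNIV (\<lambda>t. - dir_deriv ?\<phi> h (x - t *\<^sub>R h))"
      by (intro continuous_intros continuous_on_compose2[OF dir_deriv_box_bump_continuous[of UNIV]]) auto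
    then show ?thesis by (simp add: continuous_on_eq_continuous_at)
  qed
  ultimately have "(\<integral>t. - dir_deriv ?\<phi> h (x - t *\<^sub>R h) * indicator {0..1} t \<partial>lborel) = ?\<phi> (x - 1 *\<^sub>R h) - ?\<phi> (x - 0 *\<^sub>R h)"
    by (intro integral_FTC_Icc_real) auto
  then show ?thesis by simp
qed

text \<open>The set swept out by translating a compact box along a segment is compact, so a single
  box contains all the translates. It supplies the dominating functions for Fubini.\<close>

lemma cbox_enlarge:
  fixes a b h :: "'a::euclidean_space"
  shows "\<exists>c d. \<forall>t x. 0 \<le> t \<longrightarrow> t \<le> 1 \<longrightarrow> x - t *\<^sub>R h \<in> cbox a b \<longrightarrow> x \<in> cbox c d"
proof -
  have "bounded ((\<lambda>(t, y). y + t *\<^sub>R h) ` ({0..1} \<times> cbox a b))"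
    by (intro compact_imp_bounded compact_continuous_image compact_Times compact_cbox)
       (auto intro!: continuous_intros simp: split_beta)
  then obtain c d where cd: "(\<lambda>(t, y). y + t *\<^sub>R h) ` ({0..1} \<times> cbox a b) \<subseteq> cbox c d"
    using bounded_subset_cbox_symmetric by metis
  have "x \<in> cbox c d" if "0 \<le> t" "t \<le> 1" "x - t *\<^sub>R h \<in> cbox a b" for t x
    using cd that by (force simp: image_subset_iff)
  then show ?thesis by blast
qed

text \<open>Joint integrability for the Fubini exchanges below: for every t in the unit interval the
  inner integral is at most the integral of |W| over one fixed larger box.\<close>

lemma integrable_segment_average:
  fixes W :: "'a::euclidean_space \<Rightarrow> real"
  assumes [measurable]: "W \<in> borel_measurable borel"
    and W: "\<And>a b. set_integrable lborel (cbox a b) W"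
  shows "integrable (lborel \<Otimes>\<^sub>M lborel) (\<lambda>(t, x). indicator {0..1} t * indicator (cbox a b) x * W (x + t *\<^sub>R h))"
proof (rule integrableI_bounded)
  show "(\<lambda>(t, x). indicator {0..1::real} t * indicator (cbox a b) x * W (x + t *\<^sub>R h)) \<in> borel_measurable (lborel \<Otimes>\<^sub>M lborel)"
    by measurable
  obtain c d where cd: "\<And>t x. 0 \<le> t \<Longrightarrow> t \<le> 1 \<Longrightarrow> x - t *\<^sub>R h \<in> cbox a b \<Longrightarrow> x \<in> cbox c d"
    using cbox_enlarge[of h a b] by blast
  have "(\<integral>\<^sup>+p. norm (case p of (t, x) \<Rightarrow> indicator {0..1::real} t * indicator (cbox a b) x * W (x + t *\<^sub>R h)) \<partial>(lborel \<Otimes>\<^sub>M lborel))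
      = (\<integral>\<^sup>+t. \<integral>\<^sup>+x. norm (indicator {0..1::real} t * indicator (cbox a b) x * W (x + t *\<^sub>R h)) \<partial>lborel \<partial>lborel)"
    by (subst lborel.nn_integral_fst[symmetric]) auto
  also have "\<dots> \<le> (\<integral>\<^sup>+t. indicator {0..1::real} t * (\<integral>\<^sup>+x. norm (indicator (cbox c d) x * W x) \<partial>lborel) \<partial>lborel)"
  proof (rule nn_integral_mono)
    \<comment> \<open>Writing x as (x + t h) - t h makes the integrand a function of the translated
      point, the form in which translation invariance applies.\<close>
    fix t :: real
    have "(\<integral>\<^sup>+x. norm (indicator {0..1::real} t * indicator (cbox a b) x * W (x + t *\<^sub>R h)) \<partial>lborel)
        = (\<integral>\<^sup>+x. norm (indicator {0..1::real} t * indicator (cbox a b) ((x + t *\<^sub>R h) - t *\<^sub>R h) * W (x + t *\<^sub>R h)) \<partial>lborel)"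
      by simp
    also have "\<dots> = (\<integral>\<^sup>+x. norm (indicator {0..1::real} t * indicator (cbox a b) (x - t *\<^sub>R h) * W x) \<partial>lborel)"
      by (rule nn_integral_lborel_shift) measurable
    also have "\<dots> \<le> (\<integral>\<^sup>+x. indicator {0..1::real} t * norm (indicator (cbox c d) x * W x) \<partial>lborel)"
      using cd by (intro nn_integral_mono) (auto simp: indicator_def)
    also have "\<dots> = indicator {0..1::real} t * (\<integral>\<^sup>+x. norm (indicator (cbox c d) x * W x) \<partial>lborel)"
      by (cases "t \<in> {0..1}") auto
    finally show "(\<integral>\<^sup>+x. norm (indicator {0..1::real} t * indicator (cbox a b) x * W (x + t *\<^sub>R h)) \<partial>lborel)
        \<le> indicator {0..1::real} t * (\<integral>\<^sup>+x. norm (indicator (cbox c d) x * W x) \<partial>lborel)" .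
  qed
  also have "\<dots> = (\<integral>\<^sup>+x. norm (indicator (cbox c d) x * W x) \<partial>lborel)"
    by (subst nn_integral_multc) auto
  also have "\<dots> < \<infinity>"
    using W[of c d] by (simp add: set_integrable_def integrable_iff_bounded)
  finally show "(\<integral>\<^sup>+p. norm (case p of (t, x) \<Rightarrow> indicator {0..1::real} t * indicator (cbox a b) x * W (x + t *\<^sub>R h)) \<partial>(lborel \<Otimes>\<^sub>M lborel)) < \<infinity>" .
qed

lemma integrable_lborel_shift:
  fixes c :: "'a::euclidean_space" and f :: "'a \<Rightarrow> real"
  assumes "integrable lborel f"
  shows "integrable lborel (\<lambda>x. f (x + c))"
proof (rule integrableI_bounded)
  have [measurable]: "f \<in> borel_measurable borel"
    using borel_measurable_integrable[OF assms] by simp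
  show "(\<lambda>x. f (x + c)) \<in> borel_measurable lborel" by measurable
  show "(\<integral>\<^sup>+ x. norm (f (x + c)) \<partial>lborel) < \<infinity>"
    using assms by (subst nn_integral_lborel_shift) (auto simp: integrable_iff_bounded)
qed

lemma dir_deriv_box_bump_shift:
  "dir_deriv (box_bump a b n) h (x - c) = dir_deriv (box_bump (a + c) (b + c) n) h x"
proof -
  have "((\<lambda>x. box_bump a b n (x - c)) has_derivative frechet_derivative (box_bump a b n) (at (x - c))) (at x)"
  proof (rule has_derivative_compose[where f = "\<lambda>x. x - c" and f' = "\<lambda>x. x", simplified])
    show "((\<lambda>x. x - c) has_derivative (\<lambda>x. x)) (at x)"
      by (auto intro!: derivative_eq_intros)
    show "(box_bump a b n has_derivative frechet_derivative (box_bump a b n) (at (x - c))) (at (x - c))"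
      using bump_alg_differentiable[OF box_bump_in_bump_alg] frechet_derivative_works by blast
  qed
  from frechet_derivative_at[OF this] show ?thesis
    by (simp add: box_bump_shift)
qed

text \<open>Here \<open>W\<close> plays the derivative of \<open>v\<close> in direction h, known
  only weakly. Both sides are tested with a bump: the translation moves onto the bump, the bump is
  differenced along the segment, \<open>IBP\<close> transfers the derivative to \<open>W\<close> for
  each t, and translating back gives the pairing of the segment average with the bump.\<close>

lemma shift_difference_eq_segment_average:
  fixes v W :: "'a::euclidean_space \<Rightarrow> real"
  assumes [measurable]: "v \<in> borel_measurable borel" "W \<in> borel_measurable borel"
    and v: "\<And>a b. set_integrable lborel (cbox a b) v"
    and W: "\<And>a b. set_integrable lborel (cbox a b) W"
    and IBP: "\<And>a b n. (\<integral>x. v x * dir_deriv (box_bump a b n) h x \<partial>lborel) = - (\<integral>x. W x * box_bump a b n x \<partial>lborel)"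
  shows "AE x in lborel. v (x + h) - v x = (\<integral>t. indicator {0..1} t * W (x + t *\<^sub>R h) \<partial>lborel)"
proof -
  define F where "F x = (\<integral>t. indicator {0..1} t * W (x + t *\<^sub>R h) \<partial>lborel)" for x
  have [measurable]: "F \<in> borel_measurable borel"
    unfolding F_def[abs_def] by measurable
  have vh: "set_integrable lborel (cbox a b) (\<lambda>x. v (x + h))" for a b
  proof -
    have "integrable lborel (\<lambda>x. indicator (cbox (a + h) (b + h)) (x + h) * v (x + h))"
      using v[of "a + h" "b + h"] integrable_lborel_shift[of "\<lambda>x. indicator (cbox (a + h) (b + h)) x * v x" h]
      by (simp add: set_integrable_def)
    moreover have "indicat_real (cbox (a + h) (b + h)) (x + h) = indicator (cbox a b) x" for x
      by (simp add: indicator_def mem_box inner_add_left)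
    ultimately show ?thesis by (simp add: set_integrable_def)
  qed
  have F: "set_integrable lborel (cbox a b) F" for a b
  proof -
    have "(\<integral>t. indicator {0..1} t * indicator (cbox a b) x * W (x + t *\<^sub>R h) \<partial>lborel) = indicator (cbox a b) x * F x" for x
      unfolding F_def by (subst integral_mult_right_zero[symmetric]) (simp add: ac_simps)
    with lborel_pair.integrable_snd[OF integrable_segment_average[OF _ W, of a b h]] show ?thesis
      by (simp add: set_integrable_def)
  qed
  have "AE x in lborel. v (x + h) - v x - F x = 0"
  proof (rule AE_zero_if_orthogonal_to_bumps)
    show "set_integrable lborel (box a b) (\<lambda>x. v (x + h) - v x - F x)" for a b
      by (rule set_integrable_subset[of _ "cbox a b"])
         (auto intro!: set_integral_diff vh v F box_subset_cbox)
    fix a b :: 'a and n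
    let ?\<phi> = "box_bump a b n"
    have bump: "\<bar>?\<phi> x\<bar> \<le> 1 * indicator (cbox a b) x" for x
      using box_bump_nonneg[of a b n x] box_bump_le_indicator[of a b n x] box_subset_cbox[of a b]
      by (cases "x \<in> box a b") (auto simp: box_bump_eq_0)
    obtain c d where cd: "\<And>t x. 0 \<le> t \<Longrightarrow> t \<le> 1 \<Longrightarrow> x - t *\<^sub>R h \<in> cbox a b \<Longrightarrow> x \<in> cbox c d"
      using cbox_enlarge[of h a b] by blast
    obtain M where M: "0 \<le> M" "\<And>x. \<bar>dir_deriv ?\<phi> h x\<bar> \<le> M * indicator (cbox a b) x"
      using dir_deriv_box_bump_bounded[of a b n h] by blast
    have int1: "integrable lborel (\<lambda>x. v (x + h) * ?\<phi> x)"
      by (rule integrable_mult_bounded_compact_support[OF vh _ _ bump]) measurable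
    have int2: "integrable lborel (\<lambda>x. v x * ?\<phi> x)"
      by (rule integrable_mult_bounded_compact_support[OF v _ _ bump]) measurable
    have int3: "integrable lborel (\<lambda>x. F x * ?\<phi> x)"
      by (rule integrable_mult_bounded_compact_support[OF F _ _ bump]) measurable
    have int4: "integrable lborel (\<lambda>x. v x * ?\<phi> (x - h))"
      using integrable_lborel_shift[OF int1, of "- h"] by simp
    have Fub1: "integrable (lborel \<Otimes>\<^sub>M lborel) (\<lambda>(t, x). v x * (dir_deriv ?\<phi> h (x - t *\<^sub>R h) * indicator {0..1} t))"
    proof (rule Bochner_Integration.integrable_bound)
      \<comment> \<open>With shift vector 0 the lemma yields a dominating function that depends on t
        only through the indicator of the unit interval.\<close>
      show "integrable (lborel \<Otimes>\<^sub>M lborel) (\<lambda>(t, x). M * (indicator {0..1::real} t * indicator (cbox c d) x * v x))"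
        using integrable_mult_right[OF integrable_segment_average[OF _ v, of c d 0], of M]
        by (simp add: split_beta')
      show "AE p in lborel \<Otimes>\<^sub>M lborel. norm (case p of (t, x) \<Rightarrow> v x * (dir_deriv ?\<phi> h (x - t *\<^sub>R h) * indicator {0..1} t))
          \<le> norm (case p of (t, x) \<Rightarrow> M * (indicator {0..1::real} t * indicator (cbox c d) x * v x))"
      proof (rule AE_I2, clarify)
        fix t :: real and x
        show "norm (v x * (dir_deriv ?\<phi> h (x - t *\<^sub>R h) * indicator {0..1} t))
          \<le> norm (M * (indicator {0..1::real} t * indicator (cbox c d) x * v x))"
        proof (cases "t \<in> {0..1} \<and> x - t *\<^sub>R h \<in> cbox a b")
          case True
          then have "x \<in> cbox c d" using cd by auto
          moreover have "\<bar>v x\<bar> * \<bar>dir_deriv ?\<phi> h (x - t *\<^sub>R h)\<bar> \<le> \<bar>v x\<bar> * M"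
            using M(2)[of "x - t *\<^sub>R h"] True by (intro mult_left_mono) auto
          ultimately show ?thesis
            using True M(1) by (simp add: abs_mult mult.commute)
        next
          case False
          then have "dir_deriv ?\<phi> h (x - t *\<^sub>R h) * indicator {0..1} t = 0"
            by (auto simp: dir_deriv_box_bump_eq_0)
          then show ?thesis by (simp only: mult_zero_right norm_zero norm_ge_zero)
        qed
      qed
    qed measurable
    have Fub2: "integrable (lborel \<Otimes>\<^sub>M lborel) (\<lambda>(t, x). indicator {0..1::real} t * W (x + t *\<^sub>R h) * ?\<phi> x)"
    proof (rule Bochner_Integration.integrable_bound[OF integrable_segment_average[OF _ W, of a b h]])
      show "AE p in lborel \<Otimes>\<^sub>M lborel. norm (case p of (t, x) \<Rightarrow> indicator {0..1::real} t * W (x + t *\<^sub>R h) * ?\<phi> x)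
          \<le> norm (case p of (t, x) \<Rightarrow> indicator {0..1::real} t * indicator (cbox a b) x * W (x + t *\<^sub>R h))"
      proof (rule AE_I2, clarify)
        fix t :: real and x
        show "norm (indicator {0..1::real} t * W (x + t *\<^sub>R h) * ?\<phi> x) \<le> norm (indicator {0..1::real} t * indicator (cbox a b) x * W (x + t *\<^sub>R h))"
          using mult_left_mono[OF bump[of x], of "\<bar>indicator {0..1::real} t * W (x + t *\<^sub>R h)\<bar>"]
          by (simp add: abs_mult ac_simps)
      qed
    qed measurable
    have "(\<integral>x. v (x + h) * ?\<phi> x \<partial>lborel) = (\<integral>x. v (x + h) * ?\<phi> (x + h - h) \<partial>lborel)"
      by simp
    also have "\<dots> = (\<integral>x. v x * ?\<phi> (x - h) \<partial>lborel)"
      by (rule integral_lborel_shift) measurable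
    finally have "(\<integral>x. v (x + h) * ?\<phi> x \<partial>lborel) - (\<integral>x. v x * ?\<phi> x \<partial>lborel)
        = (\<integral>x. v x * (?\<phi> (x - h) - ?\<phi> x) \<partial>lborel)"
      using int2 int4 by (simp add: right_diff_distrib)
    also have "\<dots> = (\<integral>x. - (\<integral>t. v x * (dir_deriv ?\<phi> h (x - t *\<^sub>R h) * indicator {0..1} t) \<partial>lborel) \<partial>lborel)"
      by (simp add: box_bump_FTC)
    also have "\<dots> = - (\<integral>t. (\<integral>x. v x * (dir_deriv ?\<phi> h (x - t *\<^sub>R h) * indicator {0..1} t) \<partial>lborel) \<partial>lborel)"
      using lborel_pair.Fubini_integral[OF Fub1] by simp
    also have "\<dots> = - (\<integral>t. - (\<integral>x. indicator {0..1::real} t * W (x + t *\<^sub>R h) * ?\<phi> x \<partial>lborel) \<partial>lborel)"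
    proof -
      have "(\<integral>x. v x * (dir_deriv ?\<phi> h (x - t *\<^sub>R h) * indicator {0..1} t) \<partial>lborel)
          = - (\<integral>x. indicator {0..1::real} t * W (x + t *\<^sub>R h) * ?\<phi> x \<partial>lborel)" for t
      proof -
        have "(\<integral>x. v x * (dir_deriv ?\<phi> h (x - t *\<^sub>R h) * indicator {0..1} t) \<partial>lborel)
            = indicator {0..1} t * (\<integral>x. v x * dir_deriv (box_bump (a + t *\<^sub>R h) (b + t *\<^sub>R h) n) h x \<partial>lborel)"
          by (subst integral_mult_right_zero[symmetric]) (simp add: dir_deriv_box_bump_shift ac_simps)
        \<comment> \<open>\<open>IBP\<close> is used for the box translated by t h, which is why it
          is assumed for all boxes.\<close>
        also have "(\<integral>x. v x * dir_deriv (box_bump (a + t *\<^sub>R h) (b + t *\<^sub>R h) n) h x \<partial>lborel)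
            = - (\<integral>x. W x * ?\<phi> (x - t *\<^sub>R h) \<partial>lborel)"
          by (simp add: IBP box_bump_shift)
        also have "(\<integral>x. W x * ?\<phi> (x - t *\<^sub>R h) \<partial>lborel) = (\<integral>x. W (x + t *\<^sub>R h) * ?\<phi> (x + t *\<^sub>R h - t *\<^sub>R h) \<partial>lborel)"
          by (rule integral_lborel_shift[symmetric]) measurable
        also have "indicator {0..1} t * - (\<integral>x. W (x + t *\<^sub>R h) * ?\<phi> (x + t *\<^sub>R h - t *\<^sub>R h) \<partial>lborel)
            = - (\<integral>x. indicator {0..1::real} t * W (x + t *\<^sub>R h) * ?\<phi> x \<partial>lborel)"
          by (simp add: mult.assoc)
        finally show ?thesis .
      qed
      then show ?thesis by presburger
    qed
    also have "\<dots> = (\<integral>x. (\<integral>t. indicator {0..1::real} t * W (x + t *\<^sub>R h) * ?\<phi> x \<partial>lborel) \<partial>lborel)"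
      using lborel_pair.Fubini_integral[OF Fub2] by simp
    also have "\<dots> = (\<integral>x. F x * ?\<phi> x \<partial>lborel)"
      by (simp add: F_def)
    finally show "(\<integral>x. (v (x + h) - v x - F x) * ?\<phi> x \<partial>lborel) = 0"
      using int1 int2 int3 by (simp add: left_diff_distrib)
  qed
  then show ?thesis
    unfolding F_def by eventually_elim simp
qed

section \<open>Convexity inequalities for powers\<close>

lemma powr_above_tangent:
  fixes y m p :: real
  assumes "1 \<le> p" "0 \<le> y" "0 < m"
  shows "m powr p + p * m powr (p - 1) * (y - m) \<le> y powr p"
\<comment> \<open>The tangent argument runs on the open half-line. At the end point y = 0 the left
  side equals (1 - p) m^p, which is at most 0.\<close>
proof (cases "y = 0")
  case True
  have "m powr p = m powr (p - 1) * m"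
    using assms by (simp add: powr_mult_base[symmetric] mult.commute powr_diff)
  then have "m powr p + p * m powr (p - 1) * (y - m) = (1 - p) * m powr p"
    using True by (simp add: algebra_simps)
  also have "\<dots> \<le> 0" using assms by (simp add: mult_nonpos_nonneg)
  finally show ?thesis using True by simp
next
  case False
  have "(p * m powr (p - 1)) * (y - m) \<le> y powr p - m powr p"
  proof (rule convex_on_imp_above_tangent[OF powr_convex[OF assms(1)]])
    show "((\<lambda>x. x powr p) has_real_derivative p * m powr (p - 1)) (at m within {0<..})"
      using assms by (auto intro!: derivative_eq_intros)
  qed (use assms False in \<open>auto simp: interior_open\<close>)
  then show ?thesis by simp
qed

text \<open>Add the tangent bounds for |a| and |b| at their mean m: the linear terms cancel. The
  sharp constant matters, because two equal terms then give exactly 2^p, the factor that makes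
  \<open>inner_coeff\<close> nondecreasing.\<close>

lemma powr_abs_add_le:
  fixes a b p :: real
  assumes "1 \<le> p"
  shows "\<bar>a + b\<bar> powr p \<le> 2 powr (p - 1) * (\<bar>a\<bar> powr p + \<bar>b\<bar> powr p)"
proof (cases "a = 0 \<and> b = 0")
  case False
  define m where "m = (\<bar>a\<bar> + \<bar>b\<bar>) / 2"
  have m: "0 < m" using False by (auto simp: m_def)
  have "\<bar>a + b\<bar> powr p \<le> (2 * m) powr p"
    using assms abs_triangle_ineq[of a b] by (intro powr_mono2) (auto simp: m_def)
  also have "\<dots> = 2 powr (p - 1) * (2 * m powr p)"
    using m by (simp add: powr_mult powr_diff)
  also have "2 * m powr p \<le> \<bar>a\<bar> powr p + \<bar>b\<bar> powr p"
    using powr_above_tangent[OF assms _ m, of "\<bar>a\<bar>"] powr_above_tangent[OF assms _ m, of "\<bar>b\<bar>"]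
    by (simp add: m_def algebra_simps add_divide_distrib)
  finally show ?thesis by simp
qed (use assms in auto)

text \<open>Integrate the tangent bound at the mean m of |W| over the interval, which has length 1.
  \<open>W\<close> may fail to be integrable; then its Bochner integral is 0 and the left side
  vanishes.\<close>

lemma Jensen_unit_interval:
  fixes W :: "real \<Rightarrow> real"
  assumes p: "1 \<le> p" and [measurable]: "W \<in> borel_measurable borel"
  shows "ennreal (\<bar>\<integral>t. indicator {0..1} t * W t \<partial>lborel\<bar> powr p) \<le> (\<integral>\<^sup>+t. indicator {0..1} t * ennreal (\<bar>W t\<bar> powr p) \<partial>lborel)"
proof -
  let ?J = "\<lambda>t. indicator {0..1::real} t * W t"
  define m where "m = (\<integral>t. indicator {0..1} t * \<bar>W t\<bar> \<partial>lborel)"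
  have "\<bar>integral\<^sup>L lborel ?J\<bar> \<le> (\<integral>t. \<bar>?J t\<bar> \<partial>lborel)"
    by (rule integral_abs_bound)
  then have le: "\<bar>integral\<^sup>L lborel ?J\<bar> \<le> m" by (simp add: m_def abs_mult)
  have eq: "(\<integral>\<^sup>+t. indicator {0..1::real} t * ennreal (\<bar>W t\<bar> powr p) \<partial>lborel)
      = (\<integral>\<^sup>+t. ennreal (indicator {0..1::real} t * \<bar>W t\<bar> powr p) \<partial>lborel)"
    by (intro nn_integral_cong) (auto simp: indicator_def)
  show ?thesis
  proof (cases "m > 0 \<and> (\<integral>\<^sup>+t. ennreal (indicator {0..1::real} t * \<bar>W t\<bar> powr p) \<partial>lborel) < \<infinity>")
    case True
    have int_p: "integrable lborel (\<lambda>t. indicator {0..1::real} t * \<bar>W t\<bar> powr p)"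
      using True by (intro integrableI_nonneg) auto
    \<comment> \<open>A function that is not integrable would have Bochner integral 0, contradicting
      m > 0.\<close>
    have int_1: "integrable lborel (\<lambda>t. indicator {0..1::real} t * \<bar>W t\<bar>)"
      using True unfolding m_def using not_integrable_integral_eq by fastforce
    have int_i: "integrable lborel (indicator {0..1::real} :: real \<Rightarrow> real)" by simp
    have "m powr p = (\<integral>t. (m powr p - p * m powr (p - 1) * m) * indicator {0..1::real} t
        + (p * m powr (p - 1)) * (indicator {0..1::real} t * \<bar>W t\<bar>) \<partial>lborel)"
      using int_1 int_i by (simp add: m_def[symmetric])
    also have "\<dots> \<le> (\<integral>t. indicator {0..1::real} t * \<bar>W t\<bar> powr p \<partial>lborel)"
    proof (rule integral_mono[OF _ int_p])
      show "integrable lborel (\<lambda>t. (m powr p - p * m powr (p - 1) * m) * indicator {0..1::real} t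
        + (p * m powr (p - 1)) * (indicator {0..1::real} t * \<bar>W t\<bar>))"
        using int_1 int_i by simp
      show "(m powr p - p * m powr (p - 1) * m) * indicator {0..1::real} t
        + (p * m powr (p - 1)) * (indicator {0..1::real} t * \<bar>W t\<bar>) \<le> indicator {0..1::real} t * \<bar>W t\<bar> powr p" for t
        using powr_above_tangent[OF p, of "\<bar>W t\<bar>" m] True by (auto simp: indicator_def algebra_simps)
    qed
    finally have "m powr p \<le> (\<integral>t. indicator {0..1::real} t * \<bar>W t\<bar> powr p \<partial>lborel)" .
    moreover have "\<bar>integral\<^sup>L lborel ?J\<bar> powr p \<le> m powr p"
      using le p by (intro powr_mono2) auto
    ultimately show ?thesis
      unfolding eq by (subst nn_integral_eq_integral[OF int_p]) (auto intro: ennreal_leI)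
  next
    case False
    then consider "m \<le> 0" | "(\<integral>\<^sup>+t. ennreal (indicator {0..1::real} t * \<bar>W t\<bar> powr p) \<partial>lborel) = \<infinity>"
      by (metis infinity_ennreal_def less_top not_le)
    then show ?thesis
    proof cases
      case 1
      then have "integral\<^sup>L lborel ?J = 0" using le by linarith
      then show ?thesis by simp
    next
      case 2
      then show ?thesis unfolding eq by simp
    qed
  qed
qed

section \<open>Borel representatives and the translation bound\<close>

lemma borel_measurable_if_locally_integrable:
  fixes f :: "'a::euclidean_space \<Rightarrow> real"
  assumes "\<And>K. compact K \<Longrightarrow> set_integrable lebesgue K f"
  shows "f \<in> borel_measurable lebesgue"
proof (rule borel_measurable_LIMSEQ_real)
  show "(\<lambda>x. indicator (cball 0 (real n)) x * f x) \<in> borel_measurable lebesgue" for n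
    using assms[of "cball 0 (real n)"] borel_measurable_integrable
    unfolding set_integrable_def by fastforce
  fix x :: 'a
  obtain n0 :: nat where "norm x < real n0"
    using reals_Archimedean2 by blast
  then show "(\<lambda>n. indicator (cball 0 (real n)) x * f x) \<longlonglongrightarrow> f x"
    by (intro tendsto_eventually eventually_sequentiallyI[of n0]) (auto simp: indicator_def)
qed

text \<open>The definitions speak of Lebesgue measure, whereas translation and Fubini are carried
  out on \<open>lborel\<close>; Borel representatives connect the two.\<close>

lemma set_integrable_lborel_if_AE_eq:
  fixes f g :: "'a::euclidean_space \<Rightarrow> real"
  assumes "set_integrable lebesgue (cbox a b) f" and [measurable]: "g \<in> borel_measurable borel"
    and "AE x in lborel. f x = g x"
  shows "set_integrable lborel (cbox a b) g"
proof -
  have "integrable lebesgue (\<lambda>x. indicator (cbox a b) x * g x)"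
  proof (rule integrable_cong_AE_imp)
    show "integrable lebesgue (\<lambda>x. indicator (cbox a b) x * f x)"
      using assms(1) by (simp add: set_integrable_def)
    show "(\<lambda>x. indicator (cbox a b) x * g x) \<in> borel_measurable lebesgue"
      by (intro measurable_completion) measurable
    show "AE x in lebesgue. indicator (cbox a b) x * f x = indicator (cbox a b) x * g x"
      using AE_completion[OF assms(3)] by eventually_elim simp
  qed
  then show ?thesis
    by (simp add: set_integrable_def integrable_completion)
qed

text \<open>The difference is an average of the directional derivative over a segment. Jensen brings
  the power inside the average, Tonelli exchanges the integrals, and translation invariance makes
  the inner integral the same for every t. Cauchy-Schwarz finally separates the length of h.\<close>

lemma weak_gradient_shift_bound:
  fixes u v :: "'a::euclidean_space \<Rightarrow> real"
  assumes p: "1 \<le> p" and grad: "weak_gradient u g"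
    and [measurable]: "v \<in> borel_measurable borel" and uv: "AE x in lborel. u x = v x"
  shows "(\<integral>\<^sup>+x. ennreal (\<bar>v (x + h) - v x\<bar> powr p) \<partial>lborel)
    \<le> ennreal (norm h powr p) * (\<integral>\<^sup>+x. ennreal (norm (g x) powr p) \<partial>lebesgue)"
proof -
  have gi: "(\<lambda>x. g x \<bullet> i) \<in> borel_measurable lebesgue" if "i \<in> Basis" for i
    using grad that by (intro borel_measurable_if_locally_integrable) (auto simp: weak_gradient_def)
  have "\<forall>i\<in>Basis. \<exists>w\<in>borel_measurable borel. AE x in lborel. g x \<bullet> i = w x"
    using completion_ex_borel_measurable_real[OF gi] by auto
  then obtain w where w: "\<And>i. i \<in> Basis \<Longrightarrow> w i \<in> borel_measurable borel"
    "\<And>i. i \<in> Basis \<Longrightarrow> AE x in lborel. g x \<bullet> i = w i x"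
    by metis
  \<comment> \<open>Borel representatives are chosen for each coordinate and reassembled into a
    vector field.\<close>
  define G where "G x = (\<Sum>i\<in>Basis. w i x *\<^sub>R i)" for x
  have [measurable]: "G \<in> borel_measurable borel"
    unfolding G_def[abs_def] using w(1) by (intro borel_measurable_sum borel_measurable_scaleR) auto
  have gG: "AE x in lborel. g x = G x"
  proof -
    have "AE x in lborel. \<forall>i\<in>Basis. g x \<bullet> i = w i x"
      using w(2) by (intro AE_finite_allI) auto
    then show ?thesis
    proof eventually_elim
      case (elim x)
      then have "G x = (\<Sum>i\<in>Basis. (g x \<bullet> i) *\<^sub>R i)" by (simp add: G_def)
      then show ?case by (simp add: euclidean_representation)
    qed
  qed
  have v_int: "set_integrable lborel (cbox a b) v" for a b
    using grad uv by (intro set_integrable_lborel_if_AE_eq[of a b u]) (auto simp: weak_gradient_def)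
  have Gi_int: "set_integrable lborel (cbox a b) (\<lambda>x. G x \<bullet> i)" if "i \<in> Basis" for a b i
  proof (rule set_integrable_lborel_if_AE_eq)
    show "set_integrable lebesgue (cbox a b) (\<lambda>x. g x \<bullet> i)"
      using grad that by (auto simp: weak_gradient_def)
    show "AE x in lborel. g x \<bullet> i = G x \<bullet> i"
      using gG by eventually_elim simp
  qed measurable
  have expand: "(\<lambda>x. G x \<bullet> h) = (\<lambda>x. \<Sum>i\<in>Basis. (h \<bullet> i) * (G x \<bullet> i))"
    by (subst euclidean_inner) (simp add: mult.commute)
  have W_int: "set_integrable lborel (cbox a b) (\<lambda>x. G x \<bullet> h)" for a b
    unfolding expand set_integrable_def real_scaleR_def sum_distrib_left mult.left_commute[of _ "h \<bullet> _"]
    using Gi_int by (intro Bochner_Integration.integrable_sum integrable_mult_right) (simp add: set_integrable_def)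
  have IBP_i: "(\<integral>x. v x * dir_deriv (box_bump a b n) i x \<partial>lborel) = - (\<integral>x. (G x \<bullet> i) * box_bump a b n x \<partial>lborel)"
    if i: "i \<in> Basis" for a b n i
  proof -
    have [measurable]: "u \<in> borel_measurable lebesgue" "(\<lambda>x. g x \<bullet> i) \<in> borel_measurable lebesgue"
      using grad i by (auto intro!: borel_measurable_if_locally_integrable simp: weak_gradient_def)
    have [measurable]: "v \<in> borel_measurable lebesgue" "(\<lambda>x. G x \<bullet> i) \<in> borel_measurable lebesgue"
      "dir_deriv (box_bump a b n) i \<in> borel_measurable lebesgue" "box_bump a b n \<in> borel_measurable lebesgue"
      by (rule measurable_completion, measurable)+
    have "(\<integral>x. v x * dir_deriv (box_bump a b n) i x \<partial>lborel) = (\<integral>x. v x * dir_deriv (box_bump a b n) i x \<partial>lebesgue)"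
      by (rule integral_completion[symmetric]) measurable
    also have "\<dots> = (\<integral>x. u x * dir_deriv (box_bump a b n) i x \<partial>lebesgue)"
      using AE_completion[OF uv] by (intro Bochner_Integration.integral_cong_AE) auto
    also have "\<dots> = - (\<integral>x. (g x \<bullet> i) * box_bump a b n x \<partial>lebesgue)"
      using grad i test_function_box_bump[of a b n] unfolding weak_gradient_def by blast
    also have "(\<integral>x. (g x \<bullet> i) * box_bump a b n x \<partial>lebesgue) = (\<integral>x. (G x \<bullet> i) * box_bump a b n x \<partial>lebesgue)"
      using AE_completion[OF gG] by (intro Bochner_Integration.integral_cong_AE) auto
    also have "\<dots> = (\<integral>x. (G x \<bullet> i) * box_bump a b n x \<partial>lborel)"
      by (rule integral_completion) measurable
    finally show ?thesis .
  qed
  have IBP: "(\<integral>x. v x * dir_deriv (box_bump a b n) h x \<partial>lborel) = - (\<integral>x. (G x \<bullet> h) * box_bump a b n x \<partial>lborel)" for a b n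
  proof -
    let ?\<phi> = "box_bump a b n"
    \<comment> \<open>\<open>weak_gradient\<close> differentiates test functions along basis vectors
      only; linearity of the derivative extends this to the direction h.\<close>
    have lin: "dir_deriv ?\<phi> h x = (\<Sum>i\<in>Basis. (h \<bullet> i) * dir_deriv ?\<phi> i x)" for x
    proof -
      have "linear (frechet_derivative ?\<phi> (at x))"
        using bump_alg_differentiable[OF box_bump_in_bump_alg] linear_frechet_derivative by blast
      then show ?thesis
        by (subst (1) euclidean_representation[of h, symmetric]) (simp add: linear_sum linear_scale)
    qed
    have bump: "\<bar>?\<phi> x\<bar> \<le> 1 * indicator (cbox a b) x" for x
      using box_bump_nonneg[of a b n x] box_bump_le_indicator[of a b n x] box_subset_cbox[of a b]
      by (cases "x \<in> box a b") (auto simp: box_bump_eq_0)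
    have int1: "integrable lborel (\<lambda>x. v x * dir_deriv ?\<phi> i x)" for i
    proof -
      obtain M where "0 \<le> M" "\<And>x. \<bar>dir_deriv ?\<phi> i x\<bar> \<le> M * indicator (cbox a b) x"
        using dir_deriv_box_bump_bounded[of a b n i] by blast
      then show ?thesis
        by (intro integrable_mult_bounded_compact_support[OF v_int]) auto
    qed
    have int2: "integrable lborel (\<lambda>x. (G x \<bullet> i) * ?\<phi> x)" if "i \<in> Basis" for i
      by (rule integrable_mult_bounded_compact_support[OF Gi_int[OF that] _ _ bump]) measurable
    have "(\<integral>x. v x * dir_deriv ?\<phi> h x \<partial>lborel) = (\<integral>x. (\<Sum>i\<in>Basis. (h \<bullet> i) * (v x * dir_deriv ?\<phi> i x)) \<partial>lborel)"
      unfolding lin by (simp add: sum_distrib_left ac_simps)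
    also have "\<dots> = (\<Sum>i\<in>Basis. (h \<bullet> i) * (\<integral>x. v x * dir_deriv ?\<phi> i x \<partial>lborel))"
      using int1 by (subst Bochner_Integration.integral_sum) auto
    also have "\<dots> = - (\<Sum>i\<in>Basis. (h \<bullet> i) * (\<integral>x. (G x \<bullet> i) * ?\<phi> x \<partial>lborel))"
      by (simp add: IBP_i sum_negf)
    also have "(\<Sum>i\<in>Basis. (h \<bullet> i) * (\<integral>x. (G x \<bullet> i) * ?\<phi> x \<partial>lborel)) = (\<integral>x. (\<Sum>i\<in>Basis. (h \<bullet> i) * ((G x \<bullet> i) * ?\<phi> x)) \<partial>lborel)"
      using int2 by (subst Bochner_Integration.integral_sum) auto
    also have "\<dots> = (\<integral>x. (G x \<bullet> h) * ?\<phi> x \<partial>lborel)"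
      by (simp add: fun_cong[OF expand] sum_distrib_right mult.assoc)
    finally show ?thesis .
  qed
  have "AE x in lborel. v (x + h) - v x = (\<integral>t. indicator {0..1} t * (G (x + t *\<^sub>R h) \<bullet> h) \<partial>lborel)"
    by (rule shift_difference_eq_segment_average[OF _ _ v_int W_int IBP]) measurable
  then have "(\<integral>\<^sup>+x. ennreal (\<bar>v (x + h) - v x\<bar> powr p) \<partial>lborel)
     \<le> (\<integral>\<^sup>+x. (\<integral>\<^sup>+t. indicator {0..1} t * ennreal (\<bar>G (x + t *\<^sub>R h) \<bullet> h\<bar> powr p) \<partial>lborel) \<partial>lborel)"
    by (intro nn_integral_mono_AE, eventually_elim) (simp only:, rule Jensen_unit_interval[OF p], measurable)
  also have "\<dots> = (\<integral>\<^sup>+t. (\<integral>\<^sup>+x. indicator {0..1::real} t * ennreal (\<bar>G (x + t *\<^sub>R h) \<bullet> h\<bar> powr p) \<partial>lborel) \<partial>lborel)"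
    by (rule lborel_pair.Fubini') measurable
  also have "\<dots> \<le> (\<integral>\<^sup>+t. indicator {0..1::real} t * (\<integral>\<^sup>+x. ennreal (\<bar>G x \<bullet> h\<bar> powr p) \<partial>lborel) \<partial>lborel)"
  proof (rule nn_integral_mono)
    fix t :: real
    have "(\<integral>\<^sup>+x. ennreal (\<bar>G (x + t *\<^sub>R h) \<bullet> h\<bar> powr p) \<partial>lborel) = (\<integral>\<^sup>+x. ennreal (\<bar>G x \<bullet> h\<bar> powr p) \<partial>lborel)"
      by (rule nn_integral_lborel_shift) measurable
    then show "(\<integral>\<^sup>+x. indicator {0..1::real} t * ennreal (\<bar>G (x + t *\<^sub>R h) \<bullet> h\<bar> powr p) \<partial>lborel)
        \<le> indicator {0..1::real} t * (\<integral>\<^sup>+x. ennreal (\<bar>G x \<bullet> h\<bar> powr p) \<partial>lborel)"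
      by (subst nn_integral_cmult) auto
  qed
  also have "\<dots> = (\<integral>\<^sup>+x. ennreal (\<bar>G x \<bullet> h\<bar> powr p) \<partial>lborel)"
    by (subst nn_integral_multc) auto
  also have "\<dots> \<le> (\<integral>\<^sup>+x. ennreal (norm h powr p) * ennreal (norm (G x) powr p) \<partial>lborel)"
  proof (rule nn_integral_mono)
    fix x
    have "\<bar>G x \<bullet> h\<bar> powr p \<le> (norm h * norm (G x)) powr p"
      using p Cauchy_Schwarz_ineq2[of "G x" h] by (intro powr_mono2) (auto simp: mult.commute)
    then show "ennreal (\<bar>G x \<bullet> h\<bar> powr p) \<le> ennreal (norm h powr p) * ennreal (norm (G x) powr p)"
      by (simp add: powr_mult ennreal_mult[symmetric] ennreal_leI)
  qed
  also have "\<dots> = ennreal (norm h powr p) * (\<integral>\<^sup>+x. ennreal (norm (G x) powr p) \<partial>lborel)"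
    by (subst nn_integral_cmult) auto
  also have "(\<integral>\<^sup>+x. ennreal (norm (G x) powr p) \<partial>lborel) = (\<integral>\<^sup>+x. ennreal (norm (g x) powr p) \<partial>lborel)"
  proof (rule nn_integral_cong_AE)
    show "AE x in lborel. ennreal (norm (G x) powr p) = ennreal (norm (g x) powr p)"
      using gG by eventually_elim simp
  qed
  also have "\<dots> = (\<integral>\<^sup>+x. ennreal (norm (g x) powr p) \<partial>lebesgue)"
    by (simp add: nn_integral_completion)
  finally show ?thesis .
qed

section \<open>The energy as a sum over dyadic shells\<close>

text \<open>The function w of the overview, with extended values so that no finiteness has to be
  assumed.\<close>

definition shift_int :: "real \<Rightarrow> ('a::euclidean_space \<Rightarrow> real) \<Rightarrow> 'a \<Rightarrow> ennreal" where
  "shift_int p v h = (\<integral>\<^sup>+x. ennreal (\<bar>v (x + h) - v x\<bar> powr p) \<partial>lborel)"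

lemma shift_int_measurable [measurable]:
  assumes [measurable]: "v \<in> borel_measurable borel"
  shows "shift_int p v \<in> borel_measurable borel"
  unfolding shift_int_def[abs_def] by measurable

text \<open>Split the increment over 2h into two increments over h. They have the same integral by
  translation invariance.\<close>

lemma shift_int_double:
  fixes v :: "'a::euclidean_space \<Rightarrow> real"
  assumes p: "1 \<le> p" and [measurable]: "v \<in> borel_measurable borel"
  shows "shift_int p v (2 *\<^sub>R h) \<le> ennreal (2 powr p) * shift_int p v h"
proof -
  let ?f = "\<lambda>x. ennreal (\<bar>v (x + h) - v x\<bar> powr p)"
  have "shift_int p v (2 *\<^sub>R h) \<le> (\<integral>\<^sup>+x. ennreal (2 powr (p - 1)) * (?f (x + h) + ?f x) \<partial>lborel)"
    unfolding shift_int_def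
  proof (rule nn_integral_mono)
    fix x
    have "\<bar>v (x + 2 *\<^sub>R h) - v x\<bar> powr p
        \<le> 2 powr (p - 1) * (\<bar>v (x + h + h) - v (x + h)\<bar> powr p + \<bar>v (x + h) - v x\<bar> powr p)"
      using powr_abs_add_le[OF p, of "v (x + h + h) - v (x + h)" "v (x + h) - v x"]
      by (simp add: scaleR_2 add.assoc)
    then show "ennreal (\<bar>v (x + 2 *\<^sub>R h) - v x\<bar> powr p) \<le> ennreal (2 powr (p - 1)) * (?f (x + h) + ?f x)"
      by (simp add: ennreal_mult[symmetric] ennreal_plus[symmetric] ennreal_leI del: ennreal_plus)
  qed
  also have "\<dots> = ennreal (2 powr (p - 1)) * ((\<integral>\<^sup>+x. ?f (x + h) \<partial>lborel) + (\<integral>\<^sup>+x. ?f x \<partial>lborel))"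
    by (simp add: nn_integral_cmult nn_integral_add)
  also have "(\<integral>\<^sup>+x. ?f (x + h) \<partial>lborel) = (\<integral>\<^sup>+x. ?f x \<partial>lborel)"
    by (rule nn_integral_lborel_shift) measurable
  also have "ennreal (2 powr (p - 1)) * ((\<integral>\<^sup>+x. ?f x \<partial>lborel) + (\<integral>\<^sup>+x. ?f x \<partial>lborel))
      = (ennreal (2 powr (p - 1)) * 2) * shift_int p v h"
    by (simp add: shift_int_def mult_2[symmetric] mult.assoc)
  also have "ennreal (2 powr (p - 1)) * 2 = ennreal (2 powr p)"
    by (simp add: ennreal_mult''[symmetric] powr_diff flip: ennreal_numeral)
  finally show ?thesis .
qed

text \<open>A translation by at least D separates the supports, so at every point at most one of the
  two values is nonzero.\<close>

lemma shift_int_far: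
  fixes v :: "'a::euclidean_space \<Rightarrow> real"
  assumes p: "0 < p" and [measurable]: "v \<in> borel_measurable borel"
    and D: "\<And>x y. v x \<noteq> 0 \<Longrightarrow> v y \<noteq> 0 \<Longrightarrow> norm (x - y) < D" and h: "D \<le> norm h"
  shows "shift_int p v h = 2 * (\<integral>\<^sup>+x. ennreal (\<bar>v x\<bar> powr p) \<partial>lborel)"
proof -
  have "shift_int p v h = (\<integral>\<^sup>+x. ennreal (\<bar>v (x + h)\<bar> powr p) + ennreal (\<bar>v x\<bar> powr p) \<partial>lborel)"
    unfolding shift_int_def
  proof (rule nn_integral_cong)
    fix x
    have "v (x + h) = 0 \<or> v x = 0"
      using D[of "x + h" x] h by fastforce
    then show "ennreal (\<bar>v (x + h) - v x\<bar> powr p) = ennreal (\<bar>v (x + h)\<bar> powr p) + ennreal (\<bar>v x\<bar> powr p)"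
      using p by auto
  qed
  also have "\<dots> = (\<integral>\<^sup>+x. ennreal (\<bar>v (x + h)\<bar> powr p) \<partial>lborel) + (\<integral>\<^sup>+x. ennreal (\<bar>v x\<bar> powr p) \<partial>lborel)"
    by (rule nn_integral_add) measurable
  also have "(\<integral>\<^sup>+x. ennreal (\<bar>v (x + h)\<bar> powr p) \<partial>lborel) = (\<integral>\<^sup>+x. ennreal (\<bar>v x\<bar> powr p) \<partial>lborel)"
    by (rule nn_integral_lborel_shift) measurable
  finally show ?thesis by (simp add: mult_2)
qed

text \<open>Substitute y = x + h and apply Tonelli. At h = 0 both integrands are 0 by the default
  values of division and \<open>powr\<close>, so the diagonal fits in without a separate
  case.\<close>

lemma gagliardo_eq_shift_int:
  fixes v :: "'a::euclidean_space \<Rightarrow> real"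
  assumes [measurable]: "v \<in> borel_measurable borel"
  shows "(\<integral>\<^sup>+x. (\<integral>\<^sup>+y. ennreal (\<bar>v x - v y\<bar> powr p / norm (x - y) powr \<beta>) \<partial>lborel) \<partial>lborel)
    = (\<integral>\<^sup>+h. shift_int p v h * ennreal (norm h powr - \<beta>) \<partial>lborel)"
proof -
  have "(\<integral>\<^sup>+y. ennreal (\<bar>v x - v y\<bar> powr p / norm (x - y) powr \<beta>) \<partial>lborel)
      = (\<integral>\<^sup>+h. ennreal (\<bar>v (x + h) - v x\<bar> powr p) * ennreal (norm h powr - \<beta>) \<partial>lborel)" for x
  proof -
    have "(\<integral>\<^sup>+y. ennreal (\<bar>v x - v y\<bar> powr p / norm (x - y) powr \<beta>) \<partial>lborel)
        = (\<integral>\<^sup>+h. ennreal (\<bar>v x - v (h + x)\<bar> powr p / norm (x - (h + x)) powr \<beta>) \<partial>lborel)"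
      by (rule nn_integral_lborel_shift[symmetric]) measurable
    then show ?thesis
      by (simp add: ennreal_mult[symmetric] powr_minus_divide abs_minus_commute add.commute)
  qed
  then have "(\<integral>\<^sup>+x. (\<integral>\<^sup>+y. ennreal (\<bar>v x - v y\<bar> powr p / norm (x - y) powr \<beta>) \<partial>lborel) \<partial>lborel)
      = (\<integral>\<^sup>+x. (\<integral>\<^sup>+h. ennreal (\<bar>v (x + h) - v x\<bar> powr p) * ennreal (norm h powr - \<beta>) \<partial>lborel) \<partial>lborel)"
    by simp
  also have "\<dots> = (\<integral>\<^sup>+h. (\<integral>\<^sup>+x. ennreal (\<bar>v (x + h) - v x\<bar> powr p) * ennreal (norm h powr - \<beta>) \<partial>lborel) \<partial>lborel)"
    by (rule lborel_pair.Fubini') measurable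
  also have "\<dots> = (\<integral>\<^sup>+h. shift_int p v h * ennreal (norm h powr - \<beta>) \<partial>lborel)"
    unfolding shift_int_def by (intro nn_integral_cong nn_integral_multc) measurable
  finally show ?thesis .
qed

section \<open>Dyadic shells and their scale-invariant mass\<close>

definition shell :: "real \<Rightarrow> 'a::euclidean_space set" where
  "shell r = {h. r < norm h \<and> norm h \<le> 2 * r}"

lemma shell_measurable [measurable]: "shell r \<in> sets borel"
  unfolding shell_def by measurable

text \<open>The measure |h|^(-N) dh is invariant under dilations, so changing the radius by a factor
  c only replaces W by its composition with that dilation.\<close>

definition shell_mass :: "('a::euclidean_space \<Rightarrow> ennreal) \<Rightarrow> real \<Rightarrow> ennreal" where
  "shell_mass W r = (\<integral>\<^sup>+h\<in>shell r. W h * ennreal (norm h powr - real DIM('a)) \<partial>lborel)"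

text \<open>This is ln 2 times the area of the unit sphere; by dilation invariance it is the mass of
  the constant 1 on every shell.\<close>

definition shell_vol :: "'a::euclidean_space itself \<Rightarrow> ennreal" where
  "shell_vol TYPE('a) = shell_mass (\<lambda>_::'a. 1) 1"

lemma nn_integral_lborel_scale:
  fixes f :: "'a::euclidean_space \<Rightarrow> ennreal"
  assumes [measurable]: "f \<in> borel_measurable borel" and c: "0 < c"
  shows "(\<integral>\<^sup>+x. f x \<partial>lborel) = ennreal (c ^ DIM('a)) * (\<integral>\<^sup>+x. f (c *\<^sub>R x) \<partial>lborel)"
proof -
  have "(\<integral>\<^sup>+x. f x \<partial>lborel) = (\<integral>\<^sup>+x. f x \<partial>density (distr lborel borel (\<lambda>x. 0 + c *\<^sub>R x)) (\<lambda>_. \<bar>c\<bar> ^ DIM('a)))"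
    using c by (subst lborel_affine[of c 0]) auto
  also have "\<dots> = ennreal (c ^ DIM('a)) * (\<integral>\<^sup>+x. f (c *\<^sub>R x) \<partial>lborel)"
    using c by (simp add: nn_integral_density nn_integral_distr nn_integral_cmult)
  finally show ?thesis .
qed

lemma shell_mass_scale:
  fixes W :: "'a::euclidean_space \<Rightarrow> ennreal"
  assumes [measurable]: "W \<in> borel_measurable borel" and c: "0 < c"
  shows "shell_mass W (c * r) = shell_mass (\<lambda>h. W (c *\<^sub>R h)) r"
proof -
  let ?N = "real DIM('a)"
  have "shell_mass W (c * r) = ennreal (c ^ DIM('a)) *
      (\<integral>\<^sup>+h. W (c *\<^sub>R h) * ennreal (norm (c *\<^sub>R h) powr - ?N) * indicator (shell (c * r)) (c *\<^sub>R h) \<partial>lborel)"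
    unfolding shell_mass_def using c by (subst nn_integral_lborel_scale[of _ c]) auto
  also have "\<dots> = (\<integral>\<^sup>+h. ennreal (c ^ DIM('a)) * (W (c *\<^sub>R h) * ennreal (norm (c *\<^sub>R h) powr - ?N) * indicator (shell (c * r)) (c *\<^sub>R h)) \<partial>lborel)"
    by (rule nn_integral_cmult[symmetric]) measurable
  also have "\<dots> = shell_mass (\<lambda>h. W (c *\<^sub>R h)) r"
    unfolding shell_mass_def
  proof (rule nn_integral_cong)
    fix h :: 'a
    have ind: "indicator (shell (c * r)) (c *\<^sub>R h) = (indicator (shell r) h :: ennreal)"
      using c by (auto simp: indicator_def shell_def)
    have "c ^ DIM('a) * norm (c *\<^sub>R h) powr - ?N = (c ^ DIM('a) * c powr - ?N) * norm h powr - ?N"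
      using c by (simp add: powr_mult)
    also have "c ^ DIM('a) * c powr - ?N = 1"
      using c by (simp add: powr_minus powr_realpow)
    finally have "ennreal (c ^ DIM('a)) * ennreal (norm (c *\<^sub>R h) powr - ?N) = ennreal (norm h powr - ?N)"
      using c by (simp add: ennreal_mult[symmetric] del: norm_scaleR)
    then show "ennreal (c ^ DIM('a)) * (W (c *\<^sub>R h) * ennreal (norm (c *\<^sub>R h) powr - ?N) * indicator (shell (c * r)) (c *\<^sub>R h))
        = W (c *\<^sub>R h) * ennreal (norm h powr - ?N) * indicator (shell r) h"
      unfolding ind by (metis mult.assoc mult.commute)
  qed
  finally show ?thesis .
qed

lemma shell_mass_cmult:
  assumes [measurable]: "W \<in> borel_measurable borel"
  shows "shell_mass (\<lambda>h. c * W h) r = c * shell_mass W r"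
  unfolding shell_mass_def by (subst nn_integral_cmult[symmetric]) (auto simp: ac_simps)

lemma shell_mass_mono:
  assumes "\<And>h. h \<in> shell r \<Longrightarrow> W h \<le> W' h"
  shows "shell_mass W r \<le> shell_mass W' r"
  unfolding shell_mass_def using assms
  by (intro nn_integral_mono) (auto simp: indicator_def intro!: mult_right_mono)

lemma shell_mass_const:
  fixes c :: ennreal
  assumes "0 < r"
  shows "shell_mass (\<lambda>_::'a::euclidean_space. c) r = c * shell_vol TYPE('a)"
  using shell_mass_scale[of "\<lambda>_::'a. c" r 1] shell_mass_cmult[of "\<lambda>_::'a. 1" c 1] assms
  by (simp add: shell_vol_def)

lemma shell_vol_finite: "shell_vol TYPE('a::euclidean_space) < \<infinity>"
proof -
  have "shell_vol TYPE('a) \<le> (\<integral>\<^sup>+h. indicator (cball (0::'a) 2) h \<partial>lborel)"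
    unfolding shell_vol_def shell_mass_def
  proof (rule nn_integral_mono)
    fix h :: 'a
    have "norm h powr - real DIM('a) \<le> 1" if "1 < norm h"
      using powr_mono[of "- real DIM('a)" 0 "norm h"] that by (auto split: if_splits)
    then show "1 * ennreal (norm h powr - real DIM('a)) * indicator (shell 1) h \<le> indicator (cball 0 2) h"
      by (auto simp: indicator_def shell_def)
  qed
  also have "\<dots> < \<infinity>"
    using emeasure_bounded_finite[of "cball (0::'a) 2"] by simp
  finally show ?thesis .
qed

text \<open>If the integral vanished, the nonempty open set 1 < |h| < 2 would be a null set.\<close>

lemma shell_vol_pos: "0 < shell_vol TYPE('a::euclidean_space)"
proof (rule ccontr)
  assume "\<not> 0 < shell_vol TYPE('a)"
  then have "(\<integral>\<^sup>+h. 1 * ennreal (norm (h::'a) powr - real DIM('a)) * indicator (shell 1) h \<partial>lborel) = 0"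
    by (simp add: shell_vol_def shell_mass_def)
  then have "AE h in lborel. 1 * ennreal (norm (h::'a) powr - real DIM('a)) * indicator (shell 1) h = 0"
    by (subst (asm) nn_integral_0_iff_AE) auto
  then have "AE h in lborel. (h::'a) \<notin> {h. 1 < norm h \<and> norm h < 2}"
    by eventually_elim (auto simp: shell_def indicator_def)
  then have "{h::'a. 1 < norm h \<and> norm h < 2} \<in> null_sets lborel"
    by (subst (asm) AE_iff_null) auto
  then have "negligible {h::'a. 1 < norm h \<and> norm h < 2}"
    by (simp add: negligible_iff_null_sets null_sets_completionI)
  moreover have "open {h::'a. 1 < norm h \<and> norm h < 2}"
    by (intro open_Collect_conj open_Collect_less continuous_intros)
  moreover obtain b :: 'a where "b \<in> Basis" using nonempty_Basis by blast
  then have "(3/2) *\<^sub>R b \<in> {h. 1 < norm h \<and> norm h < 2}" by simp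
  ultimately show False
    using open_not_negligible by blast
qed

text \<open>Shells omit their inner sphere and contain their outer one, so adjacent dyadic shells
  are disjoint. The disjunction in \<open>disj\<close> serves both decreasing radii (towards the
  origin) and increasing ones (towards infinity).\<close>

lemma nn_integral_shell_Union:
  fixes f :: "'a::euclidean_space \<Rightarrow> ennreal"
  assumes [measurable]: "f \<in> borel_measurable borel"
    and disj: "\<And>i j::nat. i < j \<Longrightarrow> 2 * r i \<le> r j \<or> 2 * r j \<le> r i"
  shows "(\<integral>\<^sup>+h\<in>(\<Union>j. shell (r j)). f h \<partial>lborel) = (\<Sum>j. \<integral>\<^sup>+h\<in>shell (r j). f h \<partial>lborel)"
proof (rule nn_integral_disjoint_family)
  have "shell (r i) \<inter> (shell (r j) :: 'a set) = {}" if "i < j" for i j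
    using disj[OF that] by (auto simp: shell_def)
  then show "disjoint_family (\<lambda>j. shell (r j) :: 'a set)"
    unfolding disjoint_family_on_def by (metis inf_commute linorder_neqE_nat)
qed auto

lemma Union_inner_shells:
  assumes "0 < D"
  shows "(\<Union>j::nat. shell (D / 2 ^ Suc j)) = {h::'a::euclidean_space. 0 < norm h \<and> norm h \<le> D}"
proof (intro equalityI subsetI)
  fix h :: 'a assume h: "h \<in> {h. 0 < norm h \<and> norm h \<le> D}"
  \<comment> \<open>The first dyadic radius below |h|. It is not the zeroth because |h| is at most
    D, so its predecessor exists and bounds |h| from above.\<close>
  define n where "n = (LEAST n. D / 2 ^ n < norm h)"
  obtain m :: nat where "D / norm h < 2 ^ m"
    using real_arch_pow[of 2 "D / norm h"] by auto
  then have "D / 2 ^ m < norm h"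
    using h by (simp add: field_simps)
  then have n: "D / 2 ^ n < norm h"
    unfolding n_def by (rule LeastI)
  with h obtain j where j: "n = Suc j"
    by (cases n) auto
  have "j < n" using j by simp
  then have "\<not> D / 2 ^ j < norm h"
    unfolding n_def by (rule not_less_Least)
  with n j have "h \<in> shell (D / 2 ^ Suc j)"
    by (simp add: shell_def)
  then show "h \<in> (\<Union>j::nat. shell (D / 2 ^ Suc j))" by blast
next
  fix h :: 'a assume "h \<in> (\<Union>j::nat. shell (D / 2 ^ Suc j))"
  then obtain j :: nat where j: "D / 2 ^ Suc j < norm h" "norm h \<le> D / 2 ^ j"
    by (auto simp: shell_def)
  have "0 < D / 2 ^ Suc j" "D / 2 ^ j \<le> D / 1"
    using assms by (simp, intro divide_left_mono) auto
  with j show "h \<in> {h. 0 < norm h \<and> norm h \<le> D}" by auto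
qed

lemma Union_outer_shells:
  assumes "0 < D"
  shows "(\<Union>m::nat. shell (D * 2 ^ m)) = {h::'a::euclidean_space. D < norm h}"
proof (intro equalityI subsetI)
  fix h :: 'a assume h: "h \<in> {h. D < norm h}"
  define n where "n = (LEAST n. norm h \<le> D * 2 ^ n)"
  obtain m :: nat where "norm h / D < 2 ^ m"
    using real_arch_pow[of 2 "norm h / D"] by auto
  then have "norm h \<le> D * 2 ^ m"
    using assms by (simp add: field_simps)
  then have n: "norm h \<le> D * 2 ^ n"
    unfolding n_def by (rule LeastI)
  with h obtain j where j: "n = Suc j"
    by (cases n) auto
  have "j < n" using j by simp
  then have "\<not> norm h \<le> D * 2 ^ j"
    unfolding n_def by (rule not_less_Least)
  with n j have "h \<in> shell (D * 2 ^ j)"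
    by (simp add: shell_def)
  then show "h \<in> (\<Union>m::nat. shell (D * 2 ^ m))" by blast
next
  fix h :: 'a assume "h \<in> (\<Union>m::nat. shell (D * 2 ^ m))"
  then obtain j :: nat where j: "D * 2 ^ j < norm h"
    by (auto simp: shell_def)
  have "D * 1 \<le> D * 2 ^ j"
    using assms by (intro mult_left_mono) auto
  with j show "h \<in> {h. D < norm h}" by auto
qed

text \<open>The origin is the only point in no shell, hence the condition \<open>f0\<close>. The
  inner shell with j = 0 is D / 2 < |h| and |h| at most D, which explains the exponent
  \<open>Suc j\<close>.\<close>

lemma nn_integral_shell_decomposition:
  fixes f :: "'a::euclidean_space \<Rightarrow> ennreal"
  assumes [measurable]: "f \<in> borel_measurable borel" and f0: "f 0 = 0" and D: "0 < D"
  shows "(\<integral>\<^sup>+h. f h \<partial>lborel) =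
    (\<Sum>j. \<integral>\<^sup>+h\<in>shell (D / 2 ^ Suc j). f h \<partial>lborel) + (\<Sum>m. \<integral>\<^sup>+h\<in>shell (D * 2 ^ m). f h \<partial>lborel)"
proof -
  have pow: "(2::real) ^ Suc i \<le> 2 ^ j" if "i < j" for i j :: nat
    using that by (intro power_increasing) auto
  have inner: "2 * (D / 2 ^ Suc j) \<le> D / 2 ^ Suc i" if "i < j" for i j :: nat
    using divide_left_mono[OF pow[OF that], of D] D by simp
  have outer: "2 * (D * 2 ^ i) \<le> D * 2 ^ j" if "i < j" for i j :: nat
    using mult_left_mono[OF pow[OF that], of D] D by simp
  have "(\<integral>\<^sup>+h. f h \<partial>lborel) = (\<integral>\<^sup>+h. f h * indicator {h. 0 < norm h \<and> norm h \<le> D} h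
      + f h * indicator {h. D < norm h} h \<partial>lborel)"
    using f0 by (intro nn_integral_cong) (auto simp: indicator_def)
  also have "\<dots> = (\<integral>\<^sup>+h\<in>{h. 0 < norm h \<and> norm h \<le> D}. f h \<partial>lborel) + (\<integral>\<^sup>+h\<in>{h. D < norm h}. f h \<partial>lborel)"
    by (rule nn_integral_add) measurable
  also have "(\<integral>\<^sup>+h\<in>{h. 0 < norm h \<and> norm h \<le> D}. f h \<partial>lborel) = (\<Sum>j. \<integral>\<^sup>+h\<in>shell (D / 2 ^ Suc j). f h \<partial>lborel)"
    unfolding Union_inner_shells[OF D, symmetric] by (rule nn_integral_shell_Union) (use inner in auto)
  also have "(\<integral>\<^sup>+h\<in>{h. D < norm h}. f h \<partial>lborel) = (\<Sum>m. \<integral>\<^sup>+h\<in>shell (D * 2 ^ m). f h \<partial>lborel)"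
    unfolding Union_outer_shells[OF D, symmetric] by (rule nn_integral_shell_Union) (use outer in auto)
  finally show ?thesis .
qed

text \<open>The parameter \<sigma> stands for s p. The estimates below do not see u: they use only
  doubling, the constant value L beyond D, and for order 1 a bound of W by a multiple of
  |h|^p.\<close>

definition energy :: "('a::euclidean_space \<Rightarrow> ennreal) \<Rightarrow> real \<Rightarrow> ennreal" where
  "energy W \<sigma> = (\<integral>\<^sup>+h. W h * ennreal (norm h powr - (real DIM('a) + \<sigma>)) \<partial>lborel)"

lemma energy_decomposition:
  fixes W :: "'a::euclidean_space \<Rightarrow> ennreal"
  assumes [measurable]: "W \<in> borel_measurable borel" and D: "0 < D"
  shows "energy W \<sigma> = (\<Sum>j. shell_mass (\<lambda>h. W h * ennreal (norm h powr - \<sigma>)) (D / 2 ^ Suc j))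
      + (\<Sum>m. shell_mass (\<lambda>h. W h * ennreal (norm h powr - \<sigma>)) (D * 2 ^ m))"
proof -
  have "ennreal (norm h powr - (real DIM('a) + \<sigma>)) = ennreal (norm h powr - \<sigma>) * ennreal (norm h powr - real DIM('a))" for h :: 'a
  proof -
    have "- (real DIM('a) + \<sigma>) = - \<sigma> + - real DIM('a)" by simp
    then show ?thesis by (simp only: powr_add ennreal_mult powr_ge_zero)
  qed
  then have "energy W \<sigma> = (\<integral>\<^sup>+h. W h * ennreal (norm h powr - \<sigma>) * ennreal (norm h powr - real DIM('a)) \<partial>lborel)"
    by (simp add: energy_def mult.assoc)
  also have "\<dots> = (\<Sum>j. shell_mass (\<lambda>h. W h * ennreal (norm h powr - \<sigma>)) (D / 2 ^ Suc j))
      + (\<Sum>m. shell_mass (\<lambda>h. W h * ennreal (norm h powr - \<sigma>)) (D * 2 ^ m))"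
    unfolding shell_mass_def by (rule nn_integral_shell_decomposition) (use D in auto)
  finally show ?thesis .
qed

text \<open>On a shell the decreasing weight lies between its values at the radii 2r and r. This
  lemma and the next one freeze it there, at a cost of at most a factor 2^\<sigma>.\<close>

lemma shell_mass_weight_le:
  fixes W :: "'a::euclidean_space \<Rightarrow> ennreal"
  assumes [measurable]: "W \<in> borel_measurable borel" and "0 < r" "0 \<le> \<sigma>"
  shows "shell_mass (\<lambda>h. W h * ennreal (norm h powr - \<sigma>)) r \<le> ennreal (r powr - \<sigma>) * shell_mass W r"
proof -
  have "shell_mass (\<lambda>h. W h * ennreal (norm h powr - \<sigma>)) r \<le> shell_mass (\<lambda>h. ennreal (r powr - \<sigma>) * W h) r"
  proof (rule shell_mass_mono)
    fix h :: 'a assume "h \<in> shell r"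
    then have "norm h powr - \<sigma> \<le> r powr - \<sigma>"
      using assms by (intro powr_mono2') (auto simp: shell_def)
    then show "W h * ennreal (norm h powr - \<sigma>) \<le> ennreal (r powr - \<sigma>) * W h"
      by (subst mult.commute) (intro mult_right_mono ennreal_leI, auto)
  qed
  then show ?thesis by (simp add: shell_mass_cmult)
qed

lemma shell_mass_weight_ge:
  fixes W :: "'a::euclidean_space \<Rightarrow> ennreal"
  assumes [measurable]: "W \<in> borel_measurable borel" and "0 < r" "0 \<le> \<sigma>"
  shows "ennreal ((2 * r) powr - \<sigma>) * shell_mass W r \<le> shell_mass (\<lambda>h. W h * ennreal (norm h powr - \<sigma>)) r"
proof -
  have "shell_mass (\<lambda>h. ennreal ((2 * r) powr - \<sigma>) * W h) r \<le> shell_mass (\<lambda>h. W h * ennreal (norm h powr - \<sigma>)) r"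
  proof (rule shell_mass_mono)
    fix h :: 'a assume "h \<in> shell r"
    then have "(2 * r) powr - \<sigma> \<le> norm h powr - \<sigma>"
      using assms by (intro powr_mono2') (auto simp: shell_def)
    then show "ennreal ((2 * r) powr - \<sigma>) * W h \<le> W h * ennreal (norm h powr - \<sigma>)"
      by (subst mult.commute) (intro mult_left_mono ennreal_leI, auto)
  qed
  then show ?thesis by (simp add: shell_mass_cmult)
qed

text \<open>The factor \<open>2 powr (p * j)\<close> makes this sequence nondecreasing when
  \<open>W (2 *\<^sub>R h) \<le> 2 powr p * W h\<close>.\<close>
definition inner_coeff :: "('a::euclidean_space \<Rightarrow> ennreal) \<Rightarrow> real \<Rightarrow> real \<Rightarrow> nat \<Rightarrow> ennreal" where
  "inner_coeff W D p j = ennreal (2 powr (p * real j)) * shell_mass W (D / 2 ^ Suc j)"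

text \<open>For q = 2^(\<sigma> - p) the general term is 2^(\<sigma> j) times the mass of the j-th
  inner shell, so the order enters only through q.\<close>

definition inner_sum :: "('a::euclidean_space \<Rightarrow> ennreal) \<Rightarrow> real \<Rightarrow> real \<Rightarrow> real \<Rightarrow> ennreal" where
  "inner_sum W D p q = (\<Sum>j. ennreal (q ^ j) * inner_coeff W D p j)"

lemma shell_mass_double:
  fixes W :: "'a::euclidean_space \<Rightarrow> ennreal"
  assumes [measurable]: "W \<in> borel_measurable borel"
    and double: "\<And>h. W (2 *\<^sub>R h) \<le> ennreal (2 powr p) * W h"
  shows "shell_mass W (2 * r) \<le> ennreal (2 powr p) * shell_mass W r"
proof -
  have "shell_mass W (2 * r) = shell_mass (\<lambda>h. W (2 *\<^sub>R h)) r"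
    by (rule shell_mass_scale) auto
  also have "\<dots> \<le> shell_mass (\<lambda>h. ennreal (2 powr p) * W h) r"
    by (rule shell_mass_mono) (rule double)
  finally show ?thesis by (simp add: shell_mass_cmult)
qed

lemma inner_coeff_mono:
  fixes W :: "'a::euclidean_space \<Rightarrow> ennreal"
  assumes [measurable]: "W \<in> borel_measurable borel"
    and double: "\<And>h. W (2 *\<^sub>R h) \<le> ennreal (2 powr p) * W h"
  shows "inner_coeff W D p j \<le> inner_coeff W D p (Suc j)"
proof -
  have "shell_mass W (D / 2 ^ Suc j) \<le> ennreal (2 powr p) * shell_mass W (D / 2 ^ Suc (Suc j))"
    using shell_mass_double[OF assms, of "D / 2 ^ Suc (Suc j)"] by simp
  then have "inner_coeff W D p j \<le> ennreal (2 powr (p * real j)) * (ennreal (2 powr p) * shell_mass W (D / 2 ^ Suc (Suc j)))"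
    unfolding inner_coeff_def by (rule mult_left_mono) simp
  also have "\<dots> = inner_coeff W D p (Suc j)"
    by (simp add: inner_coeff_def mult.assoc[symmetric] ennreal_mult[symmetric] powr_add[symmetric] algebra_simps)
  finally show ?thesis .
qed

text \<open>W equals L on the shell between D and 2D, and one doubling step carries this lower bound
  to the first inner shell.\<close>

lemma shell_vol_le_inner_coeff_0:
  fixes W :: "'a::euclidean_space \<Rightarrow> ennreal"
  assumes [measurable]: "W \<in> borel_measurable borel" and D: "0 < D"
    and double: "\<And>h. W (2 *\<^sub>R h) \<le> ennreal (2 powr p) * W h"
    and far: "\<And>h. D \<le> norm h \<Longrightarrow> W h = L"
  shows "L * shell_vol TYPE('a) \<le> ennreal (2 powr p) * inner_coeff W D p 0"
proof -
  have "L * shell_vol TYPE('a) = shell_mass (\<lambda>_::'a. L) D"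
    using D by (simp add: shell_mass_const)
  also have "\<dots> \<le> shell_mass W (2 * (D / 2))"
    using shell_mass_mono[of D "\<lambda>_. L" W] far by (simp add: shell_def)
  also have "\<dots> \<le> ennreal (2 powr p) * shell_mass W (D / 2)"
    by (rule shell_mass_double) (use double in auto)
  finally show ?thesis by (simp add: inner_coeff_def)
qed

text \<open>The source of the factor 1 / s in the tail: the value is comparable with 1 / \<sigma>
  for bounded \<sigma>.\<close>

lemma geometric_ennreal:
  assumes "0 < \<sigma>"
  shows "(\<Sum>m. ennreal ((2 ^ m) powr - \<sigma>)) = ennreal (1 / (1 - 2 powr - \<sigma>))"
proof -
  have lt: "(2::real) powr - \<sigma> < 1"
    using powr_less_mono[of "- \<sigma>" 0 2] assms by simp
  have eq: "(2 ^ m) powr - \<sigma> = (2 powr - \<sigma>) ^ m" for m :: nat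
    by (simp add: powr_realpow[symmetric] powr_powr mult.commute)
  have "(\<lambda>m. (2 powr - \<sigma>) ^ m) sums (1 / (1 - 2 powr - \<sigma>))"
    by (rule geometric_sums) (use lt in simp)
  then show ?thesis
    unfolding eq by (intro suminf_ennreal_eq) simp
qed

lemma outer_shell_mass:
  fixes W :: "'a::euclidean_space \<Rightarrow> ennreal"
  assumes D: "0 < D" and far: "\<And>h. D \<le> norm h \<Longrightarrow> W h = L"
  shows "shell_mass W (D * 2 ^ m) = L * shell_vol TYPE('a)"
proof -
  have "D * 1 \<le> D * 2 ^ m"
    using D by (intro mult_left_mono) auto
  then have "shell_mass W (D * 2 ^ m) = shell_mass (\<lambda>_::'a. L) (D * 2 ^ m)"
    unfolding shell_mass_def by (intro nn_integral_cong) (auto simp: indicator_def shell_def far)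
  with D show ?thesis by (simp add: shell_mass_const)
qed

text \<open>At the inner radius of the j-th inner shell the weight is D^(-\<sigma>) 2^\<sigma>
  2^(\<sigma> j). As D is at least 1 and \<sigma> at most p, the first two factors are at most 2^p,
  so the order survives only in q and in the geometric sum of the tail.\<close>

lemma energy_le:
  fixes W :: "'a::euclidean_space \<Rightarrow> ennreal"
  assumes [measurable]: "W \<in> borel_measurable borel" and D: "1 \<le> D" and \<sigma>: "0 < \<sigma>" "\<sigma> \<le> p"
    and far: "\<And>h. D \<le> norm h \<Longrightarrow> W h = L"
  shows "energy W \<sigma> \<le> ennreal (2 powr p) * inner_sum W D p (2 powr (\<sigma> - p))
      + ennreal (1 / (1 - 2 powr - \<sigma>)) * (L * shell_vol TYPE('a))"
proof -
  have "(\<Sum>j. shell_mass (\<lambda>h. W h * ennreal (norm h powr - \<sigma>)) (D / 2 ^ Suc j))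
      \<le> (\<Sum>j. ennreal (2 powr p) * (ennreal ((2 powr (\<sigma> - p)) ^ j) * inner_coeff W D p j))"
  proof (rule suminf_le)
    fix j
    have "(2::real) ^ Suc j = 2 powr (1 + real j)"
      by (simp add: powr_add powr_realpow)
    then have "(D / 2 ^ Suc j) powr - \<sigma> = D powr - \<sigma> * (2 powr (1 + real j)) powr \<sigma>"
      using D by (simp only: powr_divide powr_minus_divide) (simp add: powr_minus_divide)
    also have "\<dots> = D powr - \<sigma> * 2 powr \<sigma> * 2 powr (\<sigma> * real j)"
      by (simp add: powr_powr powr_add[symmetric] algebra_simps)
    also have "\<dots> \<le> 2 powr p * 2 powr (\<sigma> * real j)"
    proof (rule mult_right_mono)
      have "D powr - \<sigma> \<le> D powr 0"
        using D \<sigma> by (intro powr_mono) auto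
      then have "D powr - \<sigma> * 2 powr \<sigma> \<le> 1 * 2 powr p"
        using D \<sigma> by (intro mult_mono powr_mono) auto
      then show "D powr - \<sigma> * 2 powr \<sigma> \<le> 2 powr p" by simp
    qed simp
    also have "2 powr (\<sigma> * real j) = (2 powr (\<sigma> - p)) ^ j * 2 powr (p * real j)"
      by (simp add: powr_realpow[symmetric] powr_powr powr_add[symmetric] algebra_simps)
    finally have "ennreal ((D / 2 ^ Suc j) powr - \<sigma>) \<le> ennreal (2 powr p) * (ennreal ((2 powr (\<sigma> - p)) ^ j) * ennreal (2 powr (p * real j)))"
      by (simp add: ennreal_mult[symmetric] ennreal_leI)
    then have "ennreal ((D / 2 ^ Suc j) powr - \<sigma>) * shell_mass W (D / 2 ^ Suc j)
        \<le> ennreal (2 powr p) * (ennreal ((2 powr (\<sigma> - p)) ^ j) * inner_coeff W D p j)"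
      unfolding inner_coeff_def mult.assoc[symmetric] by (rule mult_right_mono) simp
    with shell_mass_weight_le[of W "D / 2 ^ Suc j" \<sigma>] D \<sigma>
    show "shell_mass (\<lambda>h. W h * ennreal (norm h powr - \<sigma>)) (D / 2 ^ Suc j)
        \<le> ennreal (2 powr p) * (ennreal ((2 powr (\<sigma> - p)) ^ j) * inner_coeff W D p j)"
      by (auto intro: order_trans)
  qed auto
  also have "\<dots> = ennreal (2 powr p) * inner_sum W D p (2 powr (\<sigma> - p))"
    by (simp add: inner_sum_def)
  finally have 1: "(\<Sum>j. shell_mass (\<lambda>h. W h * ennreal (norm h powr - \<sigma>)) (D / 2 ^ Suc j))
      \<le> ennreal (2 powr p) * inner_sum W D p (2 powr (\<sigma> - p))" .
  have "(\<Sum>m. shell_mass (\<lambda>h. W h * ennreal (norm h powr - \<sigma>)) (D * 2 ^ m))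
      \<le> (\<Sum>m. ennreal ((2 ^ m) powr - \<sigma>) * (L * shell_vol TYPE('a)))"
  proof (rule suminf_le)
    fix m :: nat
    have "shell_mass (\<lambda>h. W h * ennreal (norm h powr - \<sigma>)) (D * 2 ^ m) \<le> ennreal ((D * 2 ^ m) powr - \<sigma>) * (L * shell_vol TYPE('a))"
      using shell_mass_weight_le[of W "D * 2 ^ m" \<sigma>] outer_shell_mass[of D W L m] far D \<sigma> by auto
    also have "\<dots> \<le> ennreal ((2 ^ m) powr - \<sigma>) * (L * shell_vol TYPE('a))"
      using D \<sigma> by (intro mult_right_mono ennreal_leI powr_mono2') auto
    finally show "shell_mass (\<lambda>h. W h * ennreal (norm h powr - \<sigma>)) (D * 2 ^ m) \<le> ennreal ((2 ^ m) powr - \<sigma>) * (L * shell_vol TYPE('a))" .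
  qed auto
  also have "\<dots> = ennreal (1 / (1 - 2 powr - \<sigma>)) * (L * shell_vol TYPE('a))"
    using \<sigma> by (simp only: ennreal_suminf_multc geometric_ennreal)
  finally have 2: "(\<Sum>m. shell_mass (\<lambda>h. W h * ennreal (norm h powr - \<sigma>)) (D * 2 ^ m))
      \<le> ennreal (1 / (1 - 2 powr - \<sigma>)) * (L * shell_vol TYPE('a))" .
  have "0 < D" using D by simp
  then show ?thesis
    unfolding energy_decomposition[OF assms(1) \<open>0 < D\<close>] by (intro add_mono 1 2)
qed

text \<open>The counterpart with outer radii: D^(-\<sigma>) and (2D)^(-\<sigma>) are bounded below
  by the same powers with exponent -p.\<close>

lemma energy_ge:
  fixes W :: "'a::euclidean_space \<Rightarrow> ennreal"
  assumes [measurable]: "W \<in> borel_measurable borel" and D: "1 \<le> D" and \<sigma>: "0 < \<sigma>" "\<sigma> \<le> p"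
    and far: "\<And>h. D \<le> norm h \<Longrightarrow> W h = L"
  shows "ennreal (D powr - p) * inner_sum W D p (2 powr (\<sigma> - p))
      + ennreal ((2 * D) powr - p * (1 / (1 - 2 powr - \<sigma>))) * (L * shell_vol TYPE('a)) \<le> energy W \<sigma>"
proof -
  have "ennreal (D powr - p) * inner_sum W D p (2 powr (\<sigma> - p))
      = (\<Sum>j. ennreal (D powr - p) * (ennreal ((2 powr (\<sigma> - p)) ^ j) * inner_coeff W D p j))"
    by (simp add: inner_sum_def)
  also have "\<dots> \<le> (\<Sum>j. shell_mass (\<lambda>h. W h * ennreal (norm h powr - \<sigma>)) (D / 2 ^ Suc j))"
  proof (rule suminf_le)
    fix j
    have "D powr - p * ((2 powr (\<sigma> - p)) ^ j * 2 powr (p * real j)) = D powr - p * 2 powr (\<sigma> * real j)"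
      by (simp add: powr_realpow[symmetric] powr_powr powr_add[symmetric] algebra_simps)
    also have "\<dots> \<le> D powr - \<sigma> * 2 powr (\<sigma> * real j)"
      using D \<sigma> by (intro mult_right_mono powr_mono) auto
    also have "\<dots> = D powr - \<sigma> * (2 powr real j) powr \<sigma>"
      by (simp add: powr_powr mult.commute)
    also have "\<dots> = (2 * (D / 2 ^ Suc j)) powr - \<sigma>"
      using D by (simp add: powr_divide powr_minus_divide powr_realpow)
    finally have "ennreal (D powr - p) * (ennreal ((2 powr (\<sigma> - p)) ^ j) * ennreal (2 powr (p * real j))) \<le> ennreal ((2 * (D / 2 ^ Suc j)) powr - \<sigma>)"
      by (simp add: ennreal_mult[symmetric] ennreal_leI)
    then have "ennreal (D powr - p) * (ennreal ((2 powr (\<sigma> - p)) ^ j) * inner_coeff W D p j)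
       \<le> ennreal ((2 * (D / 2 ^ Suc j)) powr - \<sigma>) * shell_mass W (D / 2 ^ Suc j)"
      unfolding inner_coeff_def mult.assoc[symmetric] by (rule mult_right_mono) simp
    also have "\<dots> \<le> shell_mass (\<lambda>h. W h * ennreal (norm h powr - \<sigma>)) (D / 2 ^ Suc j)"
      using D \<sigma> by (intro shell_mass_weight_ge) auto
    finally show "ennreal (D powr - p) * (ennreal ((2 powr (\<sigma> - p)) ^ j) * inner_coeff W D p j)
       \<le> shell_mass (\<lambda>h. W h * ennreal (norm h powr - \<sigma>)) (D / 2 ^ Suc j)" .
  qed auto
  finally have 1: "ennreal (D powr - p) * inner_sum W D p (2 powr (\<sigma> - p))
      \<le> (\<Sum>j. shell_mass (\<lambda>h. W h * ennreal (norm h powr - \<sigma>)) (D / 2 ^ Suc j))" .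
  have "ennreal ((2 * D) powr - p * (1 / (1 - 2 powr - \<sigma>))) * (L * shell_vol TYPE('a))
      = (\<Sum>m. ennreal ((2 * D) powr - p) * ennreal ((2 ^ m) powr - \<sigma>) * (L * shell_vol TYPE('a)))"
    using \<sigma> powr_mono[of "- \<sigma>" 0 2]
    by (simp only: ennreal_suminf_multc ennreal_suminf_cmult geometric_ennreal) (simp add: ennreal_mult[symmetric])
  also have "\<dots> \<le> (\<Sum>m. shell_mass (\<lambda>h. W h * ennreal (norm h powr - \<sigma>)) (D * 2 ^ m))"
  proof (rule suminf_le)
    fix m :: nat
    have "(2 * D) powr - p * (2 ^ m) powr - \<sigma> \<le> (2 * D) powr - \<sigma> * (2 ^ m) powr - \<sigma>"
      using D \<sigma> by (intro mult_right_mono powr_mono) auto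
    also have "\<dots> = (2 * (D * 2 ^ m)) powr - \<sigma>"
      using D by (simp add: powr_mult ac_simps)
    finally have "ennreal ((2 * D) powr - p) * ennreal ((2 ^ m) powr - \<sigma>) * (L * shell_vol TYPE('a))
        \<le> ennreal ((2 * (D * 2 ^ m)) powr - \<sigma>) * (L * shell_vol TYPE('a))"
      by (intro mult_right_mono) (auto simp: ennreal_mult[symmetric] ennreal_leI)
    also have "\<dots> \<le> shell_mass (\<lambda>h. W h * ennreal (norm h powr - \<sigma>)) (D * 2 ^ m)"
      using shell_mass_weight_ge[of W "D * 2 ^ m" \<sigma>] outer_shell_mass[of D W L m] far D \<sigma> by auto
    finally show "ennreal ((2 * D) powr - p) * ennreal ((2 ^ m) powr - \<sigma>) * (L * shell_vol TYPE('a))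
        \<le> shell_mass (\<lambda>h. W h * ennreal (norm h powr - \<sigma>)) (D * 2 ^ m)" .
  qed auto
  finally have 2: "ennreal ((2 * D) powr - p * (1 / (1 - 2 powr - \<sigma>))) * (L * shell_vol TYPE('a))
      \<le> (\<Sum>m. shell_mass (\<lambda>h. W h * ennreal (norm h powr - \<sigma>)) (D * 2 ^ m))" .
  have "0 < D" using D by simp
  then show ?thesis
    unfolding energy_decomposition[OF assms(1) \<open>0 < D\<close>] by (intro add_mono 1 2)
qed

section \<open>Monotonicity in the order\<close>

text \<open>Increasing the ratio moves the geometric distribution to the right, which increases the
  expectation of a nondecreasing sequence.\<close>
lemma geometric_expectation_mono:
  fixes b :: "nat \<Rightarrow> ennreal"
  assumes mono: "\<And>j. b j \<le> b (Suc j)" and q: "0 \<le> q" "q \<le> Q" "Q < 1"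
  shows "ennreal (1 - q) * (\<Sum>j. ennreal (q ^ j) * b j) \<le> ennreal (1 - Q) * (\<Sum>j. ennreal (Q ^ j) * b j)"
proof -
  \<comment> \<open>Q = 0 forces q = 0, and for Q > 0 an infinite coefficient makes the right side
    infinite. What remains is real-valued.\<close>
  consider "Q = 0" | j where "0 < Q" "b j = \<infinity>" | "0 < Q" "\<And>j. b j \<noteq> \<infinity>"
    using q by fastforce
  then show ?thesis
  proof cases
    case 1
    with q show ?thesis by simp
  next
    case (2 j)
    have "(\<Sum>i\<in>{j}. ennreal (Q ^ i) * b i) \<le> (\<Sum>i. ennreal (Q ^ i) * b i)"
      by (rule sum_le_suminf) auto
    moreover have "(\<Sum>i\<in>{j}. ennreal (Q ^ i) * b i) = \<infinity>"
      using 2 by (simp add: ennreal_mult_top)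
    ultimately have "(\<Sum>i. ennreal (Q ^ i) * b i) = \<infinity>"
      by (simp add: top_unique)
    with q show ?thesis by (simp add: ennreal_mult_top)
  next
    case 3
    define r where "r j = enn2real (b j)" for j
    have b: "b j = ennreal (r j)" and r0: "0 \<le> r j" for j
      using 3(2)[of j] by (simp_all add: r_def less_top)
    have r_mono: "r j \<le> r (Suc j)" for j
      using mono[of j] r0 by (simp add: b)
    have r_mono': "r n \<le> r (i + n)" for n i
      by (induction i) (auto intro: order_trans r_mono)
    \<comment> \<open>\<open>H n x\<close> is the expectation of r at min(J, n), where J is
      geometric with ratio x and exceeds n - 1 with probability x^n. Its increment in n is x^(n+1)
      (r(n+1) - r(n)), which is monotone in x: summation by parts.\<close>
    define H where "H n x = (1 - x) * (\<Sum>j<n. x ^ j * r j) + x ^ n * r n" for n x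
    have H_le: "H n q \<le> H n Q" for n
    proof (induction n)
      case (Suc n)
      have step: "H (Suc n) x = H n x + x ^ Suc n * (r (Suc n) - r n)" for x
        by (simp add: H_def algebra_simps)
      have "q ^ Suc n * (r (Suc n) - r n) \<le> Q ^ Suc n * (r (Suc n) - r n)"
        using q r_mono by (intro mult_right_mono power_mono) auto
      with Suc show ?case by (simp only: step add_mono)
    qed (simp add: H_def)
    have "(\<Sum>j<n. ennreal (1 - q) * (ennreal (q ^ j) * b j)) \<le> ennreal (1 - Q) * (\<Sum>j. ennreal (Q ^ j) * b j)" for n
    proof -
      \<comment> \<open>The terms from n on are at least those of the constant r(n), and the
        geometric weights from n on have total Q^n.\<close>
      have tail: "ennreal (Q ^ n * r n) \<le> ennreal (1 - Q) * (\<Sum>i. ennreal (Q ^ (i + n)) * b (i + n))"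
      proof -
        have "(\<lambda>i. Q ^ i) sums (1 / (1 - Q))"
          using q by (intro geometric_sums) simp
        then have geo: "(\<Sum>i. ennreal (Q ^ i)) = ennreal (1 / (1 - Q))"
          using q by (intro suminf_ennreal_eq) auto
        have "Q ^ n * r n = (1 - Q) * (1 / (1 - Q) * (Q ^ n * r n))"
          using q by simp
        then have "ennreal (Q ^ n * r n) = ennreal (1 - Q) * (ennreal (1 / (1 - Q)) * ennreal (Q ^ n * r n))"
          using q r0 by (simp add: ennreal_mult[symmetric] del: times_divide_eq_left)
        also have "\<dots> = ennreal (1 - Q) * (\<Sum>i. ennreal (Q ^ i) * ennreal (Q ^ n * r n))"
          by (simp only: geo[symmetric] ennreal_suminf_multc)
        also have "\<dots> \<le> ennreal (1 - Q) * (\<Sum>i. ennreal (Q ^ (i + n)) * b (i + n))"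
        proof (intro mult_left_mono suminf_le)
          fix i
          have "Q ^ i * (Q ^ n * r n) \<le> Q ^ (i + n) * r (i + n)"
            using q r_mono' by (simp add: power_add mult.assoc mult_left_mono)
          then show "ennreal (Q ^ i) * ennreal (Q ^ n * r n) \<le> ennreal (Q ^ (i + n)) * b (i + n)"
            using q r0 by (simp add: b ennreal_mult[symmetric] ennreal_leI)
        qed auto
        finally show ?thesis .
      qed
      have "(\<Sum>j<n. ennreal (1 - q) * (ennreal (q ^ j) * b j)) = ennreal ((1 - q) * (\<Sum>j<n. q ^ j * r j))"
        using q r0 by (simp add: b ennreal_mult[symmetric] sum_ennreal sum_distrib_left)
      also have "\<dots> \<le> ennreal (H n q)"
        using q r0 by (intro ennreal_leI) (simp add: H_def)
      also have "\<dots> \<le> ennreal (H n Q)"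
        by (intro ennreal_leI H_le)
      also have "\<dots> = ennreal ((1 - Q) * (\<Sum>j<n. Q ^ j * r j)) + ennreal (Q ^ n * r n)"
        unfolding H_def using q r0 by (intro ennreal_plus mult_nonneg_nonneg sum_nonneg) auto
      also have "ennreal ((1 - Q) * (\<Sum>j<n. Q ^ j * r j)) = ennreal (1 - Q) * (\<Sum>j<n. ennreal (Q ^ j) * b j)"
        using q r0 by (simp add: b ennreal_mult[symmetric] sum_ennreal sum_nonneg)
      also have "\<dots> + ennreal (Q ^ n * r n) \<le> \<dots> + ennreal (1 - Q) * (\<Sum>i. ennreal (Q ^ (i + n)) * b (i + n))"
        by (intro add_left_mono tail)
      also have "\<dots> = ennreal (1 - Q) * (\<Sum>j. ennreal (Q ^ j) * b j)"
      proof -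
        have "(\<Sum>j. ennreal (Q ^ j) * b j) = (\<Sum>i. ennreal (Q ^ (i + n)) * b (i + n)) + (\<Sum>j<n. ennreal (Q ^ j) * b j)"
          by (rule suminf_offset) simp
        then show ?thesis by (simp only: distrib_left add.commute)
      qed
      finally show ?thesis .
    qed
    then have "(\<Sum>j. ennreal (1 - q) * (ennreal (q ^ j) * b j)) \<le> ennreal (1 - Q) * (\<Sum>j. ennreal (Q ^ j) * b j)"
      by (intro suminf_le_const) auto
    then show ?thesis by simp
  qed
qed

text \<open>Compare with ratio 0, whose geometric law is the point mass at 0 because 0 ^ 0 =
  1.\<close>

lemma geometric_expectation_ge_first:
  fixes b :: "nat \<Rightarrow> ennreal"
  assumes mono: "\<And>j. b j \<le> b (Suc j)" and Q: "0 \<le> Q" "Q < 1"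
  shows "b 0 \<le> ennreal (1 - Q) * (\<Sum>j. ennreal (Q ^ j) * b j)"
proof -
  have "b 0 = (\<Sum>j\<in>{0}. ennreal (0 ^ j) * b j)" by simp
  also have "\<dots> \<le> (\<Sum>j. ennreal (0 ^ j) * b j)"
    by (rule sum_le_suminf) auto
  also have "\<dots> \<le> ennreal (1 - Q) * (\<Sum>j. ennreal (Q ^ j) * b j)"
    using geometric_expectation_mono[of b 0 Q, OF mono] Q by simp
  finally show ?thesis .
qed

section \<open>Energy estimates with explicit dependence on the order\<close>

lemma one_minus_two_powr_le: "0 \<le> x \<Longrightarrow> 1 - 2 powr - x \<le> (x::real)"
proof -
  assume x: "0 \<le> x"
  have "ln 2 \<le> (1::real)" using ln_le_minus_one[of 2] by simp
  then have "x * ln 2 \<le> x * 1" using x by (intro mult_left_mono) auto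
  with exp_ge_add_one_self[of "- x * ln 2"] show ?thesis
    by (simp add: powr_def)
qed

text \<open>With y = x ln 2, the bound exp y >= 1 + y gives 1 - exp(-y) >= y / (1 + y), and y is at
  most p ln 2. Taken at x = s p and x = p - s p, the two bounds make the geometric factors
  comparable with s and 1 - s.\<close>

lemma one_minus_two_powr_ge:
  fixes x p :: real
  assumes "0 \<le> x" "x \<le> p"
  shows "ln 2 / (1 + p * ln 2) * x \<le> 1 - 2 powr - x"
proof -
  let ?y = "x * ln 2"
  have y: "0 \<le> ?y" "?y \<le> p * ln 2" using assms by (auto intro: mult_right_mono)
  then have pos: "0 < 1 + ?y" "0 < 1 + p * ln 2" by linarith+
  have "ln 2 / (1 + p * ln 2) * x = ?y / (1 + p * ln 2)" by simp
  also have "\<dots> \<le> ?y / (1 + ?y)"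
    using y pos by (intro divide_left_mono mult_pos_pos) auto
  also have "\<dots> = 1 - 1 / (1 + ?y)" using pos by (simp add: field_simps)
  also have "\<dots> \<le> 1 - 1 / exp ?y"
    using pos exp_ge_add_one_self[of ?y] by (intro diff_left_mono divide_left_mono mult_pos_pos) auto
  also have "\<dots> = 1 - 2 powr - x"
    by (simp add: powr_def exp_minus divide_inverse)
  finally show ?thesis .
qed

lemma inner_sum_mono:
  fixes W :: "'a::euclidean_space \<Rightarrow> ennreal"
  assumes [measurable]: "W \<in> borel_measurable borel"
    and double: "\<And>h. W (2 *\<^sub>R h) \<le> ennreal (2 powr p) * W h" and q: "0 \<le> q" "q \<le> Q" "Q < 1"
  shows "ennreal (1 - q) * inner_sum W D p q \<le> ennreal (1 - Q) * inner_sum W D p Q"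
  unfolding inner_sum_def
  by (intro geometric_expectation_mono inner_coeff_mono double q) measurable

lemma shell_vol_le_inner_sum:
  fixes W :: "'a::euclidean_space \<Rightarrow> ennreal"
  assumes [measurable]: "W \<in> borel_measurable borel" and D: "0 < D"
    and double: "\<And>h. W (2 *\<^sub>R h) \<le> ennreal (2 powr p) * W h"
    and far: "\<And>h. D \<le> norm h \<Longrightarrow> W h = L" and Q: "0 \<le> Q" "Q < 1"
  shows "L * shell_vol TYPE('a) \<le> ennreal (2 powr p) * (ennreal (1 - Q) * inner_sum W D p Q)"
proof -
  have "L * shell_vol TYPE('a) \<le> ennreal (2 powr p) * inner_coeff W D p 0"
    using assms by (intro shell_vol_le_inner_coeff_0) auto
  also have "\<dots> \<le> ennreal (2 powr p) * (ennreal (1 - Q) * inner_sum W D p Q)"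
    unfolding inner_sum_def
    by (intro mult_left_mono geometric_expectation_ge_first inner_coeff_mono double Q) auto
  finally show ?thesis .
qed

text \<open>The inner part bounds the left side x by K (1 - S) times the energy, the tail by K S
  times the energy, with K = p (2D)^p. Weighting these by S and 1 - S and adding gives x at most 2 K
  S (1 - S) times the energy.\<close>

lemma energy_Poincare:
  fixes W :: "'a::euclidean_space \<Rightarrow> ennreal"
  assumes [measurable]: "W \<in> borel_measurable borel" and D: "1 \<le> D" and p: "1 \<le> p"
    and double: "\<And>h. W (2 *\<^sub>R h) \<le> ennreal (2 powr p) * W h"
    and far: "\<And>h. D \<le> norm h \<Longrightarrow> W h = L" and S: "0 < S" "S < 1"
  shows "L * shell_vol TYPE('a) \<le> ennreal (2 * p * (2 * D) powr p * (S * (1 - S))) * energy W (S * p)"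
proof (cases "energy W (S * p) = \<infinity>")
  case True
  with p D S show ?thesis by (simp add: ennreal_mult_top)
next
  case False
  let ?B = "inner_sum W D p (2 powr (S * p - p))" and ?X = "L * shell_vol TYPE('a)"
  have Sp: "0 < S * p" "S * p \<le> p" "S * p < p" using S p by auto
  have \<tau>: "0 < 1 - 2 powr - (S * p)" "1 - 2 powr - (S * p) \<le> S * p"
    using Sp powr_less_mono[of "- (S * p)" 0 2] one_minus_two_powr_le[of "S * p"] by auto
  have \<theta>: "0 < 1 - 2 powr (S * p - p)" "1 - 2 powr (S * p - p) \<le> (1 - S) * p"
    using Sp powr_less_mono[of "S * p - p" 0 2] one_minus_two_powr_le[of "p - S * p"] by (auto simp: algebra_simps)
  obtain e where e: "0 \<le> e" "energy W (S * p) = ennreal e"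
    using False by (cases "energy W (S * p)") auto
  have ge: "ennreal (D powr - p) * ?B + ennreal ((2 * D) powr - p * (1 / (1 - 2 powr - (S * p)))) * ?X \<le> ennreal e"
    unfolding e(2)[symmetric] using D Sp far by (intro energy_ge) auto
  then have "ennreal (D powr - p) * ?B < \<infinity>" "ennreal ((2 * D) powr - p * (1 / (1 - 2 powr - (S * p)))) * ?X < \<infinity>"
    by (auto simp: less_top[symmetric] top_unique)
  \<comment> \<open>Finite energy makes both summands of its lower bound finite, so the rest is real
    arithmetic.\<close>
  then have "?B \<noteq> \<infinity>" "?X \<noteq> \<infinity>"
    using D \<tau> S p by (auto simp: ennreal_mult_top)
  then obtain b x where b: "0 \<le> b" "?B = ennreal b" and x: "0 \<le> x" "?X = ennreal x"
    by (cases ?B; cases ?X) auto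
  have 1: "D powr - p * b + (2 * D) powr - p * (1 / (1 - 2 powr - (S * p))) * x \<le> e"
    using ge \<tau> e(1) b(1) x(1) unfolding b(2) x(2)
    by (simp add: ennreal_mult[symmetric] ennreal_plus[symmetric] del: ennreal_plus)
  have "?X \<le> ennreal (2 powr p) * (ennreal (1 - 2 powr (S * p - p)) * ?B)"
    using D far \<theta> by (intro shell_vol_le_inner_sum double) auto
  then have 2: "x \<le> 2 powr p * ((1 - 2 powr (S * p - p)) * b)"
    using \<theta> b(1) x(1) unfolding b(2) x(2) by (simp add: ennreal_mult[symmetric])
  have "D powr - p * b \<le> e" "(2 * D) powr - p * (1 / (1 - 2 powr - (S * p))) * x \<le> e"
    using 1 b(1) x(1) \<tau> D by (smt (verit) mult_nonneg_nonneg powr_ge_zero zero_le_divide_1_iff)+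
  then have be: "b \<le> D powr p * e" and xe: "x \<le> (2 * D) powr p * (1 - 2 powr - (S * p)) * e"
    using D \<tau> by (simp_all add: powr_minus field_simps)
  have "x \<le> 2 powr p * (((1 - S) * p) * (D powr p * e))"
    by (rule order_trans[OF 2]) (use \<theta> b be in \<open>intro mult_left_mono mult_mono; simp\<close>)
  also have "\<dots> = (2 * D) powr p * p * (1 - S) * e"
    using D by (simp add: powr_mult)
  \<comment> \<open>The weights S and 1 - S sum to 1, so the two weighted bounds add up to a bound
    for x itself.\<close>
  finally have "S * x \<le> S * ((2 * D) powr p * p * (1 - S) * e)"
    using S by (intro mult_left_mono) auto
  moreover have "x \<le> (2 * D) powr p * (S * p) * e"
    by (rule order_trans[OF xe]) (use \<tau> e in \<open>intro mult_right_mono mult_left_mono; simp\<close>)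
  then have "(1 - S) * x \<le> (1 - S) * ((2 * D) powr p * (S * p) * e)"
    using S by (intro mult_left_mono) auto
  ultimately have "x \<le> 2 * p * (2 * D) powr p * (S * (1 - S)) * e"
    by (simp add: algebra_simps)
  then show ?thesis
    unfolding e(2) x(2) using p S e(1) by (simp add: ennreal_mult[symmetric] ennreal_leI)
qed

text \<open>The factor 1 - s is traded for 1 - q in the inner part, and s cancels the 1 / s of the
  tail. The s left in the first coefficient is kept on purpose: \<open>energy_compare\<close>
  enlarges it to S to rebuild S (1 - S).\<close>

lemma energy_le_normalised:
  fixes W :: "'a::euclidean_space \<Rightarrow> ennreal" and p :: real
  defines "c \<equiv> ln 2 / (1 + p * ln 2)"
  assumes [measurable]: "W \<in> borel_measurable borel" and D: "1 \<le> D" and p: "1 \<le> p"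
    and far: "\<And>h. D \<le> norm h \<Longrightarrow> W h = L" and s: "0 < s" "s < 1"
  shows "ennreal (s * (1 - s)) * energy W (s * p) \<le>
      ennreal (2 powr p / (c * p) * s) * (ennreal (1 - 2 powr (s * p - p)) * inner_sum W D p (2 powr (s * p - p)))
      + ennreal (1 / (c * p)) * (L * shell_vol TYPE('a))"
proof -
  let ?B = "inner_sum W D p (2 powr (s * p - p))" and ?X = "L * shell_vol TYPE('a)"
  let ?\<tau> = "1 - 2 powr - (s * p)" and ?\<theta> = "1 - 2 powr (s * p - p)"
  have sp: "0 < s * p" "s * p \<le> p" "s * p < p" using s p by auto
  have c: "0 < c" using p unfolding c_def by (intro divide_pos_pos) (auto intro: add_pos_nonneg)
  have \<tau>: "0 < ?\<tau>" "c * (s * p) \<le> ?\<tau>"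
    using sp powr_less_mono[of "- (s * p)" 0 2] one_minus_two_powr_ge[of "s * p" p] by (auto simp: c_def)
  have \<theta>: "0 < ?\<theta>" "c * (p - s * p) \<le> ?\<theta>"
    using sp powr_less_mono[of "s * p - p" 0 2] one_minus_two_powr_ge[of "p - s * p" p] by (auto simp: c_def)
  have "ennreal (s * (1 - s)) * energy W (s * p)
      \<le> ennreal (s * (1 - s)) * (ennreal (2 powr p) * ?B + ennreal (1 / ?\<tau>) * ?X)"
    using D sp far by (intro mult_left_mono energy_le) auto
  also have "\<dots> = ennreal (s * (1 - s) * 2 powr p) * ?B + ennreal (s * (1 - s) * (1 / ?\<tau>)) * ?X"
  proof -
    have 1: "ennreal (s * (1 - s) * 2 powr p) = ennreal (s * (1 - s)) * ennreal (2 powr p)"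
      by (rule ennreal_mult) (use s in auto)
    have 2: "ennreal (s * (1 - s) * (1 / ?\<tau>)) = ennreal (s * (1 - s)) * ennreal (1 / ?\<tau>)"
      by (rule ennreal_mult) (use s \<tau> in auto)
    show ?thesis unfolding 1 2 distrib_left by (simp only: ac_simps)
  qed
  also have "\<dots> \<le> ennreal (2 powr p / (c * p) * s * ?\<theta>) * ?B + ennreal (1 / (c * p)) * ?X"
  proof (intro add_mono mult_right_mono ennreal_leI)
    have "s * (1 - s) * 2 powr p = 2 powr p / (c * p) * s * (c * (p - s * p))"
      using c p by (simp add: field_simps)
    also have "\<dots> \<le> 2 powr p / (c * p) * s * ?\<theta>"
      using \<theta> s c p by (intro mult_left_mono) auto
    finally show "s * (1 - s) * 2 powr p \<le> 2 powr p / (c * p) * s * ?\<theta>" .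
    have "s * (1 - s) * (1 / ?\<tau>) \<le> s * 1 * (1 / (c * (s * p)))"
      using \<tau> s c p sp by (intro mult_mono divide_left_mono) auto
    also have "\<dots> = 1 / (c * p)" using s by simp
    finally show "s * (1 - s) * (1 / ?\<tau>) \<le> 1 / (c * p)" .
  qed auto
  also have "ennreal (2 powr p / (c * p) * s * ?\<theta>) * ?B = ennreal (2 powr p / (c * p) * s) * (ennreal ?\<theta> * ?B)"
    unfolding mult.assoc[symmetric, of "ennreal _"]
    by (subst ennreal_mult) (use \<theta> s c p in auto)
  finally show ?thesis .
qed

lemma ennreal_mult_mult:
  "0 \<le> a \<Longrightarrow> 0 \<le> b \<Longrightarrow> ennreal a * (ennreal b * x) = ennreal (a * b) * x"
  by (simp add: ennreal_mult mult.assoc)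

text \<open>The inner part goes from s to S by monotonicity of the geometric expectation; the tail
  term is absorbed by \<open>energy_Poincare\<close>. These contribute 1 and 2 to the constant
  3.\<close>

lemma energy_compare:
  fixes W :: "'a::euclidean_space \<Rightarrow> ennreal" and p :: real
  defines "c \<equiv> ln 2 / (1 + p * ln 2)"
  assumes [measurable]: "W \<in> borel_measurable borel" and D: "1 \<le> D" and p: "1 \<le> p"
    and double: "\<And>h. W (2 *\<^sub>R h) \<le> ennreal (2 powr p) * W h"
    and far: "\<And>h. D \<le> norm h \<Longrightarrow> W h = L" and s: "0 < s" "s \<le> S" "S < 1"
  shows "ennreal (s * (1 - s)) * energy W (s * p) \<le> ennreal (3 * (2 * D) powr p / c) * (ennreal (S * (1 - S)) * energy W (S * p))"
proof -
  let ?q = "\<lambda>s. 2 powr (s * p - p)" and ?X = "L * shell_vol TYPE('a)"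
  have c: "0 < c" using p unfolding c_def by (intro divide_pos_pos) (auto intro: add_pos_nonneg)
  have q: "0 \<le> ?q s" "?q s \<le> ?q S" "?q S < 1"
    using s p powr_less_mono[of "S * p - p" 0 2] by auto
  have Sp: "0 < S * p" "S * p \<le> p" using s p by auto
  have \<theta>: "1 - ?q S \<le> (1 - S) * p"
    using Sp one_minus_two_powr_le[of "p - S * p"] by (auto simp: algebra_simps)
  have "ennreal (D powr - p) * inner_sum W D p (?q S) \<le> energy W (S * p)"
    using energy_ge[of W D "S * p" p L] D Sp far by (auto intro: order_trans[OF add_increasing2])
  then have "ennreal (D powr p) * (ennreal (D powr - p) * inner_sum W D p (?q S)) \<le> ennreal (D powr p) * energy W (S * p)"
    by (rule mult_left_mono) simp
  moreover have "ennreal (D powr p) * ennreal (D powr - p) = 1"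
    using D by (simp add: ennreal_mult[symmetric] powr_add[symmetric])
  ultimately have B: "inner_sum W D p (?q S) \<le> ennreal (D powr p) * energy W (S * p)"
    by (simp add: mult.assoc[symmetric])
  have "ennreal (2 powr p / (c * p) * s) * (ennreal (1 - ?q s) * inner_sum W D p (?q s))
      \<le> ennreal (2 powr p / (c * p) * S) * (ennreal (1 - ?q S) * inner_sum W D p (?q S))"
    using s c p q by (intro mult_mono ennreal_leI mult_left_mono inner_sum_mono double) auto
  also have "\<dots> \<le> ennreal (2 powr p / (c * p) * S) * (ennreal ((1 - S) * p) * (ennreal (D powr p) * energy W (S * p)))"
    using \<theta> B by (intro mult_left_mono mult_mono ennreal_leI) auto
  also have "\<dots> = ennreal ((2 * D) powr p / c * (S * (1 - S))) * energy W (S * p)"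
  proof -
    have "2 powr p / (c * p) * S * ((1 - S) * p * D powr p) = (2 * D) powr p / c * (S * (1 - S))"
      using p D c by (simp add: powr_mult field_simps)
    moreover have "0 \<le> 2 powr p / (c * p) * S" "0 \<le> (1 - S) * p" "0 \<le> D powr p" "0 \<le> (1 - S) * p * D powr p"
      using s c p by auto
    ultimately show ?thesis
      by (simp only: ennreal_mult_mult)
  qed
  finally have 1: "ennreal (2 powr p / (c * p) * s) * (ennreal (1 - ?q s) * inner_sum W D p (?q s))
      \<le> ennreal ((2 * D) powr p / c * (S * (1 - S))) * energy W (S * p)" .
  have "ennreal (1 / (c * p)) * ?X \<le> ennreal (1 / (c * p)) * (ennreal (2 * p * (2 * D) powr p * (S * (1 - S))) * energy W (S * p))"
    using D p far s by (intro mult_left_mono energy_Poincare double) auto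
  also have "\<dots> = ennreal (2 * (2 * D) powr p / c * (S * (1 - S))) * energy W (S * p)"
  proof -
    have "1 / (c * p) * (2 * p * (2 * D) powr p * (S * (1 - S))) = 2 * (2 * D) powr p / c * (S * (1 - S))"
      using p c by (simp add: field_simps)
    moreover have "0 \<le> 1 / (c * p)" "0 \<le> 2 * p * (2 * D) powr p * (S * (1 - S))"
      using s c p by auto
    ultimately show ?thesis
      by (simp only: ennreal_mult_mult)
  qed
  finally have 2: "ennreal (1 / (c * p)) * ?X \<le> ennreal (2 * (2 * D) powr p / c * (S * (1 - S))) * energy W (S * p)" .
  have "ennreal (s * (1 - s)) * energy W (s * p) \<le>
      ennreal (2 powr p / (c * p) * s) * (ennreal (1 - ?q s) * inner_sum W D p (?q s)) + ennreal (1 / (c * p)) * ?X"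
    unfolding c_def using D p far s by (intro energy_le_normalised) auto
  also have "\<dots> \<le> ennreal ((2 * D) powr p / c * (S * (1 - S))) * energy W (S * p)
      + ennreal (2 * (2 * D) powr p / c * (S * (1 - S))) * energy W (S * p)"
    by (intro add_mono 1 2)
  also have "\<dots> = ennreal ((2 * D) powr p / c * (S * (1 - S)) + 2 * (2 * D) powr p / c * (S * (1 - S))) * energy W (S * p)"
    using s c by (subst ennreal_plus) (auto simp: distrib_right)
  also have "(2 * D) powr p / c * (S * (1 - S)) + 2 * (2 * D) powr p / c * (S * (1 - S)) = 3 * (2 * D) powr p / c * (S * (1 - S))"
    by (simp add: algebra_simps add_divide_distrib[symmetric])
  also have "ennreal (3 * (2 * D) powr p / c * (S * (1 - S))) * energy W (S * p) =
      ennreal (3 * (2 * D) powr p / c) * (ennreal (S * (1 - S)) * energy W (S * p))"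
    using s c by (subst ennreal_mult) (auto simp: mult.assoc)
  finally show ?thesis .
qed

text \<open>The case S = 1. The bound by |h|^p makes the inner coefficients bounded, so their
  geometric expectation obeys the same bound for every ratio. The two equal contributions of inner
  part and tail give the factor 2.\<close>

lemma energy_gradient_bound:
  fixes W :: "'a::euclidean_space \<Rightarrow> ennreal" and p :: real
  defines "c \<equiv> ln 2 / (1 + p * ln 2)"
  assumes [measurable]: "W \<in> borel_measurable borel" and D: "1 \<le> D" and p: "1 \<le> p"
    and lip: "\<And>h. W h \<le> ennreal (norm h powr p) * G"
    and far: "\<And>h. D \<le> norm h \<Longrightarrow> W h = L" and s: "0 < s" "s < 1"
  shows "ennreal (s * (1 - s)) * energy W (s * p) \<le> ennreal (2 * (2 * D) powr p / (c * p)) * (G * shell_vol TYPE('a))"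
proof -
  let ?q = "2 powr (s * p - p)" and ?X = "L * shell_vol TYPE('a)"
  have c: "0 < c" using p unfolding c_def by (intro divide_pos_pos) (auto intro: add_pos_nonneg)
  have sp: "0 < s * p" "s * p < p" using s p by auto
  have q: "0 \<le> ?q" "?q < 1"
    using sp powr_less_mono[of "s * p - p" 0 2] by auto
  have coeff: "inner_coeff W D p j \<le> ennreal (D powr p) * (G * shell_vol TYPE('a))" for j
  proof -
    have "shell_mass W (D / 2 ^ Suc j) \<le> shell_mass (\<lambda>_::'a. ennreal ((D / 2 ^ j) powr p) * G) (D / 2 ^ Suc j)"
    proof (rule shell_mass_mono)
      fix h :: 'a assume "h \<in> shell (D / 2 ^ Suc j)"
      then have "norm h powr p \<le> (D / 2 ^ j) powr p"
        using p by (intro powr_mono2) (auto simp: shell_def)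
      then show "W h \<le> ennreal ((D / 2 ^ j) powr p) * G"
        by (intro order_trans[OF lip] mult_right_mono ennreal_leI) auto
    qed
    also have "\<dots> = ennreal ((D / 2 ^ j) powr p) * G * shell_vol TYPE('a)"
      using D by (intro shell_mass_const) simp
    finally have "inner_coeff W D p j \<le> ennreal (2 powr (p * real j)) * (ennreal ((D / 2 ^ j) powr p) * G * shell_vol TYPE('a))"
      unfolding inner_coeff_def by (intro mult_left_mono) auto
    also have "\<dots> = ennreal (2 powr (p * real j) * (D / 2 ^ j) powr p) * (G * shell_vol TYPE('a))"
      by (simp add: ennreal_mult mult.assoc)
    \<comment> \<open>The outer radius of the j-th shell is D / 2^j, so the normalising power of 2
      cancels exactly and the bound does not depend on j.\<close>
    also have "2 powr (p * real j) * (D / 2 ^ j) powr p = D powr p"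
    proof -
      have "2 powr (p * real j) = (2 ^ j) powr p"
        by (simp add: powr_realpow[symmetric] powr_powr mult.commute)
      then show ?thesis using D by (simp add: powr_divide)
    qed
    finally show ?thesis .
  qed
  have "ennreal (1 - ?q) * inner_sum W D p ?q \<le> ennreal (1 - ?q) * (\<Sum>j. ennreal (?q ^ j) * (ennreal (D powr p) * (G * shell_vol TYPE('a))))"
    unfolding inner_sum_def by (intro mult_left_mono suminf_le coeff) auto
  also have "\<dots> = (ennreal (1 - ?q) * (\<Sum>j. ennreal (?q ^ j))) * (ennreal (D powr p) * (G * shell_vol TYPE('a)))"
    by (simp only: ennreal_suminf_multc mult.assoc)
  also have "ennreal (1 - ?q) * (\<Sum>j. ennreal (?q ^ j)) = 1"
  proof -
    have "(\<lambda>i. ?q ^ i) sums (1 / (1 - ?q))"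
      using q by (intro geometric_sums) simp
    then have "(\<Sum>i. ennreal (?q ^ i)) = ennreal (1 / (1 - ?q))"
      by (intro suminf_ennreal_eq) auto
    moreover have "ennreal (1 - ?q) * ennreal (1 / (1 - ?q)) = 1"
      using q by (subst ennreal_mult[symmetric]) auto
    ultimately show ?thesis by simp
  qed
  finally have 1: "ennreal (1 - ?q) * inner_sum W D p ?q \<le> ennreal (D powr p) * (G * shell_vol TYPE('a))" by simp
  have 2: "?X \<le> ennreal (D powr p) * (G * shell_vol TYPE('a))"
  proof -
    \<comment> \<open>A vector of length exactly D obeys both \<open>far\<close> and
      \<open>lip\<close>, which bounds L.\<close>
    obtain b :: 'a where b: "b \<in> Basis" using nonempty_Basis by blast
    then have "norm (D *\<^sub>R b) = D" using D by simp
    with far[of "D *\<^sub>R b"] lip[of "D *\<^sub>R b"] have "L \<le> ennreal (D powr p) * G" by simp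
    then show ?thesis
      unfolding mult.assoc[symmetric] by (rule mult_right_mono) simp
  qed
  have "ennreal (s * (1 - s)) * energy W (s * p) \<le>
      ennreal (2 powr p / (c * p) * s) * (ennreal (1 - ?q) * inner_sum W D p ?q) + ennreal (1 / (c * p)) * ?X"
    unfolding c_def using D p far s by (intro energy_le_normalised) auto
  also have "\<dots> \<le> ennreal (2 powr p / (c * p)) * (ennreal (D powr p) * (G * shell_vol TYPE('a)))
      + ennreal (2 powr p / (c * p)) * (ennreal (D powr p) * (G * shell_vol TYPE('a)))"
  proof (rule add_mono)
    have "2 powr p / (c * p) * s \<le> 2 powr p / (c * p)"
      using s c p by (intro mult_right_le_one_le) auto
    then show "ennreal (2 powr p / (c * p) * s) * (ennreal (1 - ?q) * inner_sum W D p ?q)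
        \<le> ennreal (2 powr p / (c * p)) * (ennreal (D powr p) * (G * shell_vol TYPE('a)))"
      by (intro mult_mono[OF ennreal_leI 1]) auto
    have "1 / (c * p) \<le> 2 powr p / (c * p)"
      using c p powr_mono[of 0 p 2] by (intro divide_right_mono) auto
    then show "ennreal (1 / (c * p)) * ?X \<le> ennreal (2 powr p / (c * p)) * (ennreal (D powr p) * (G * shell_vol TYPE('a)))"
      by (intro mult_mono[OF ennreal_leI 2]) auto
  qed
  also have "\<dots> = ennreal (2 * (2 powr p / (c * p) * D powr p)) * (G * shell_vol TYPE('a))"
  proof -
    have nn: "0 \<le> 2 powr p / (c * p)" "0 \<le> D powr p" "0 \<le> 2 powr p / (c * p) * D powr p"
      using c p by auto
    show ?thesis
      unfolding ennreal_mult_mult[OF nn(1,2)] mult_2 ennreal_plus[OF nn(3) nn(3)] distrib_right ..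
  qed
  also have "2 * (2 powr p / (c * p) * D powr p) = 2 * (2 * D) powr p / (c * p)"
    using D by (simp add: powr_mult)
  finally show ?thesis .
qed

section \<open>Two-sided bounds for the normalising constant\<close>

lemma c_const_bounds:
  assumes p: "1 < p" and N: "1 \<le> N"
  shows "\<exists>m M. 0 < m \<and> 0 < M \<and> (\<forall>s\<in>{0<..<1}. m * (s * (1 - s)) \<le> c_const N s p \<and> c_const N s p \<le> M * (s * (1 - s)))"
proof -
  \<comment> \<open>Since Gamma(2 - s) = (1 - s) Gamma(1 - s), this is \<open>c_const\<close>
    divided by s (1 - s), extended continuously to the closed interval. It is positive there, so
    compactness supplies both bounds.\<close>
  define f where "f s = 2 powr (2 * s - 1) * Gamma ((p * s + p + real N - 2) / 2) / (pi powr (real N / 2) * Gamma (2 - s))" for s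
  have arg: "0 < (p * s + p + real N - 2) / 2" if "s \<in> {0..1}" for s
  proof -
    have "0 \<le> p * s" using p that by auto
    then show ?thesis using p N by simp
  qed
  have nonpos_Ints: "x \<notin> \<int>\<^sub>\<le>\<^sub>0" if "0 < x" for x :: real
    using that by (auto elim!: nonpos_Ints_cases)
  have f_pos: "0 < f s" if "s \<in> {0..1}" for s
    unfolding f_def using arg[OF that] that by (intro divide_pos_pos mult_pos_pos Gamma_real_pos) auto
  have "continuous_on {0..1} f"
  proof -
    have 1: "continuous_on {0..1} (\<lambda>s. Gamma ((p * s + p + real N - 2) / 2))"
      by (rule continuous_on_compose2[OF continuous_on_Gamma[of "{0<..}"]])
         (use arg nonpos_Ints in \<open>auto intro!: continuous_intros\<close>)
    have 2: "continuous_on {0..1} (\<lambda>s::real. Gamma (2 - s))"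
      by (rule continuous_on_compose2[OF continuous_on_Gamma[of "{0<..}"]])
         (use nonpos_Ints in \<open>auto intro!: continuous_intros\<close>)
    show ?thesis
      unfolding f_def
    proof (intro continuous_on_divide continuous_on_mult 1 2 continuous_intros ballI)
      fix s :: real assume "s \<in> {0..1}"
      then have "0 < Gamma (2 - s)" by (intro Gamma_real_pos) auto
      then show "pi powr (real N / 2) * Gamma (2 - s) \<noteq> 0" by simp
    qed auto
  qed
  then obtain s0 s1 where s01: "s0 \<in> {0..1}" "s1 \<in> {0..1}" "\<And>s. s \<in> {0..1} \<Longrightarrow> f s0 \<le> f s" "\<And>s. s \<in> {0..1} \<Longrightarrow> f s \<le> f s1"
    using continuous_attains_inf[of "{0..1::real}" f] continuous_attains_sup[of "{0..1::real}" f] by auto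
  have eq: "c_const N s p = f s * (s * (1 - s))" if "s \<in> {0<..<1}" for s
  proof -
    have "Gamma (2 - s) = (1 - s) * Gamma (1 - s)"
      using Gamma_plus1[of "1 - s"] nonpos_Ints[of "1 - s"] that by (simp add: algebra_simps)
    note Gamma_2 = this
    have "0 < Gamma (1 - s)" using that by (intro Gamma_real_pos) auto
    then show ?thesis
      unfolding c_const_def f_def Gamma_2 using that by simp
  qed
  show ?thesis
  proof (rule exI[of _ "f s0"], rule exI[of _ "f s1"], intro conjI ballI)
    fix s :: real assume s: "s \<in> {0<..<1}"
    then have "0 \<le> s * (1 - s)" "s \<in> {0..1}" by auto
    then show "f s0 * (s * (1 - s)) \<le> c_const N s p" "c_const N s p \<le> f s1 * (s * (1 - s))"
      unfolding eq[OF s] using s01 by (auto intro!: mult_right_mono)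
  qed (use s01 f_pos in auto)
qed

lemma enn_root_le:
  assumes K: "0 < K" and p: "0 < p" and le: "X \<le> ennreal K * Y"
  shows "enn_root p X \<le> ennreal (K powr (1 / p)) * enn_root p Y"
proof (cases "Y = \<infinity>")
  case True
  then show ?thesis using K by (simp add: enn_root_def ennreal_mult_top)
next
  case False
  then obtain y where y: "0 \<le> y" "Y = ennreal y" by (cases Y) auto
  with le K have "X \<le> ennreal (K * y)" by (simp add: ennreal_mult)
  then obtain x where x: "0 \<le> x" "X = ennreal x" by (cases X) (auto simp: top_unique)
  have "x \<le> K * y" using \<open>X \<le> ennreal (K * y)\<close> x K y by simp
  then have "x powr (1 / p) \<le> K powr (1 / p) * y powr (1 / p)"
    using x(1) y(1) K p powr_mono2[of "1 / p" x "K * y"] by (simp add: powr_mult)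
  then show ?thesis
    using x y by (simp add: enn_root_def ennreal_mult[symmetric] ennreal_leI)
qed

section \<open>The comparison theorem\<close>

text \<open>Multiplying by the indicator makes the support condition hold at every point, as
  \<open>shift_int_far\<close> demands, and not just almost everywhere.\<close>

lemma borel_version_supported:
  fixes u :: "'a::euclidean_space \<Rightarrow> real"
  assumes "open \<Omega>" and "u \<in> borel_measurable lebesgue" and "AE x in lebesgue. x \<notin> \<Omega> \<longrightarrow> u x = 0"
  obtains v where "v \<in> borel_measurable borel" "AE x in lborel. u x = v x" "\<And>x. v x \<noteq> 0 \<Longrightarrow> x \<in> \<Omega>"
proof -
  obtain v0 where v0: "v0 \<in> borel_measurable borel" "AE x in lborel. u x = v0 x"
    using completion_ex_borel_measurable_real[OF assms(2)] by auto
  have [measurable]: "\<Omega> \<in> sets borel" using assms(1) by simp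
  show ?thesis
  proof (rule that)
    show "(\<lambda>x. v0 x * indicator \<Omega> x) \<in> borel_measurable borel" using v0(1) by measurable
    have "AE x in lborel. x \<notin> \<Omega> \<longrightarrow> u x = 0" using assms(3) by (simp add: AE_completion_iff)
    with v0(2) show "AE x in lborel. u x = v0 x * indicator \<Omega> x"
      by eventually_elim (auto simp: indicator_def)
    show "x \<in> \<Omega>" if "v0 x * indicator \<Omega> x \<noteq> 0" for x
      using that by (auto simp: indicator_def split: if_splits)
  qed
qed

lemma seminorm_0_eq:
  assumes "AE x in lborel. u x = v x"
  shows "seminorm_sp 0 p u = enn_root p (\<integral>\<^sup>+x. ennreal (\<bar>v x\<bar> powr p) \<partial>lborel)"
proof -
  have "(\<integral>\<^sup>+x. ennreal (\<bar>u x\<bar> powr p) \<partial>lborel) = (\<integral>\<^sup>+x. ennreal (\<bar>v x\<bar> powr p) \<partial>lborel)"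
  proof (rule nn_integral_cong_AE)
    show "AE x in lborel. ennreal (\<bar>u x\<bar> powr p) = ennreal (\<bar>v x\<bar> powr p)"
      using assms by eventually_elim simp
  qed
  then show ?thesis by (simp add: seminorm_sp_def nn_integral_completion)
qed

lemma seminorm_fractional_eq:
  fixes u v :: "'a::euclidean_space \<Rightarrow> real"
  assumes uv: "AE x in lborel. u x = v x" and v: "v \<in> borel_measurable borel" and s: "0 < s" "s < 1"
  shows "seminorm_sp s p u = enn_root p (ennreal (c_const DIM('a) s p) * energy (shift_int p v) (s * p))"
proof -
  let ?F = "\<lambda>w x y. ennreal (\<bar>w x - w y\<bar> powr p / norm (x - y) powr (real DIM('a) + s * p))"
  have "(\<integral>\<^sup>+x. (\<integral>\<^sup>+y. ?F u x y \<partial>lborel) \<partial>lborel) = (\<integral>\<^sup>+x. (\<integral>\<^sup>+y. ?F v x y \<partial>lborel) \<partial>lborel)"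
  proof (rule nn_integral_cong_AE)
    show "AE x in lborel. (\<integral>\<^sup>+y. ?F u x y \<partial>lborel) = (\<integral>\<^sup>+y. ?F v x y \<partial>lborel)"
      using uv
    proof eventually_elim
      case (elim x)
      show ?case
      proof (rule nn_integral_cong_AE)
        show "AE y in lborel. ?F u x y = ?F v x y"
          using uv by eventually_elim (simp add: elim)
      qed
    qed
  qed
  also have "\<dots> = energy (shift_int p v) (s * p)"
    unfolding energy_def by (rule gagliardo_eq_shift_int[OF v])
  finally show ?thesis
    using s by (simp add: seminorm_sp_def nn_integral_completion)
qed

text \<open>The estimates hold for every weak gradient, so they apply to whichever one
  \<open>SOME\<close> selects.\<close>

lemma seminorm_1_cases:
  fixes u :: "'a::euclidean_space \<Rightarrow> real"
  obtains "seminorm_sp 1 p u = \<infinity>"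
  | g where "weak_gradient u g" "seminorm_sp 1 p u = enn_root p (\<integral>\<^sup>+x. ennreal (norm (g x) powr p) \<partial>lebesgue)"
proof (cases "\<exists>g. weak_gradient u g \<and> (\<integral>\<^sup>+ x. ennreal (norm (g x) powr p) \<partial>lebesgue) < \<infinity>")
  case True
  show ?thesis
    by (rule that(2)[OF someI_ex[OF True, THEN conjunct1]]) (unfold seminorm_sp_def if_P[OF True], simp)
next
  case False
  show ?thesis
    by (rule that(1)) (unfold seminorm_sp_def if_not_P[OF False], simp)
qed

theorem theorem3p2:
  fixes \<Omega> :: "'a::euclidean_space set" and p :: real
  assumes "open \<Omega>" and "bounded \<Omega>" and "1 < p" and "p < real DIM('a)"
  shows "\<exists>C>0. \<forall>s S (u :: 'a \<Rightarrow> real).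
           0 \<le> s \<longrightarrow> s \<le> S \<longrightarrow> S \<le> 1 \<longrightarrow>
           u \<in> borel_measurable lebesgue \<longrightarrow>
           (AE x in lebesgue. x \<notin> \<Omega> \<longrightarrow> u x = 0) \<longrightarrow>
           seminorm_sp s p u \<le> ennreal C * seminorm_sp S p u"
proof -
  have p: "1 \<le> p" "0 < p" using assms(3) by auto
  obtain B where B: "0 < B" "\<And>x. x \<in> \<Omega> \<Longrightarrow> norm x \<le> B"
    using assms(2) by (auto simp: bounded_pos)
  \<comment> \<open>Strictly larger than all distances within \<Omega>, and at least 1.\<close>
  define D where "D = 2 * B + 1"
  have D: "1 \<le> D" "0 < D" using B by (auto simp: D_def)
  have diam: "norm (x - y) < D" if "x \<in> \<Omega>" "y \<in> \<Omega>" for x y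
    using norm_triangle_ineq4[of x y] B(2)[OF that(1)] B(2)[OF that(2)] by (simp add: D_def)
  obtain m M where m: "0 < m" "0 < M"
    and mM: "\<And>s. s \<in> {0<..<1} \<Longrightarrow> m * (s * (1 - s)) \<le> c_const DIM('a) s p \<and> c_const DIM('a) s p \<le> M * (s * (1 - s))"
    using c_const_bounds[OF assms(3), of "DIM('a)"] by auto
  obtain \<kappa> where \<kappa>: "0 < \<kappa>" "shell_vol TYPE('a) = ennreal \<kappa>"
    using shell_vol_pos[where 'a = 'a] shell_vol_finite[where 'a = 'a]
    by (cases "shell_vol TYPE('a)") auto
  define c where "c = ln 2 / (1 + p * ln 2)"
  have c: "0 < c" using p unfolding c_def by (intro divide_pos_pos) (auto intro: add_pos_nonneg)
  \<comment> \<open>One constant per case: \<open>K1\<close> for s = 0 < S < 1, \<open>K2\<close>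
    for s = 0 and S = 1, \<open>K3\<close> for 0 < s and S < 1, \<open>K4\<close> for 0 < s < 1 = S.
    The factors 1 / (2 \<kappa>) and 1 / 2 undo L = 2 U, in \<open>K1\<close> together with the
    shell volume; m and M exchange s (1 - s) for \<open>c_const\<close>.\<close>
  define K1 where "K1 = 1 / (2 * \<kappa>) * (2 * p * (2 * D) powr p / m)"
  define K2 where "K2 = 1 / 2 * D powr p"
  define K3 where "K3 = M * (3 * (2 * D) powr p / c) / m"
  define K4 where "K4 = M * (2 * (2 * D) powr p / (c * p) * \<kappa>)"
  \<comment> \<open>The summand 1 settles s = S and makes C positive, so the right side is infinite
    when u has no gradient in L^p.\<close>
  define C where "C = 1 + K1 powr (1 / p) + K2 powr (1 / p) + K3 powr (1 / p) + K4 powr (1 / p)"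
  have K: "0 < K1" "0 < K2" "0 < K3" "0 < K4"
    using p D m \<kappa> c by (auto simp: K1_def K2_def K3_def K4_def)
  have C: "1 \<le> C" "K1 powr (1 / p) \<le> C" "K2 powr (1 / p) \<le> C" "K3 powr (1 / p) \<le> C" "K4 powr (1 / p) \<le> C"
    by (auto simp: C_def intro: add_nonneg_nonneg)
  have main: "seminorm_sp s p u \<le> ennreal C * seminorm_sp S p u"
    if s: "0 \<le> s" "s \<le> S" "S \<le> 1" and u: "u \<in> borel_measurable lebesgue" and u0: "AE x in lebesgue. x \<notin> \<Omega> \<longrightarrow> u x = 0"
    for s S and u :: "'a \<Rightarrow> real"
  proof -
    obtain v where v [measurable]: "v \<in> borel_measurable borel" and uv: "AE x in lborel. u x = v x"
      and supp: "\<And>x. v x \<noteq> 0 \<Longrightarrow> x \<in> \<Omega>"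
      using borel_version_supported[OF assms(1) u u0] by blast
    define W where "W = shift_int p v"
    define U where "U = (\<integral>\<^sup>+x. ennreal (\<bar>v x\<bar> powr p) \<partial>lborel)"
    have W: "W \<in> borel_measurable borel" unfolding W_def by measurable
    have double: "W (2 *\<^sub>R h) \<le> ennreal (2 powr p) * W h" for h
      unfolding W_def by (rule shift_int_double[OF p(1) v])
    have far: "W h = 2 * U" if "D \<le> norm h" for h
      unfolding W_def U_def by (rule shift_int_far[OF p(2) v _ that]) (use diam supp in blast)
    have lip: "W h \<le> ennreal (norm h powr p) * (\<integral>\<^sup>+x. ennreal (norm (g x) powr p) \<partial>lebesgue)"
      if "weak_gradient u g" for g h
      unfolding W_def shift_int_def by (rule weak_gradient_shift_bound[OF p(1) that v uv])
    have lower: "ennreal (r * (1 - r)) * energy W (r * p) \<le> ennreal (1 / m) * (ennreal (c_const DIM('a) r p) * energy W (r * p))"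
      and upper: "ennreal (c_const DIM('a) r p) * energy W (r * p) \<le> ennreal M * (ennreal (r * (1 - r)) * energy W (r * p))"
      if r: "0 < r" "r < 1" for r
    proof -
      have "0 \<le> r * (1 - r)" using r by simp
      then have c0: "0 \<le> c_const DIM('a) r p"
        using mM[of r] r m by (meson greaterThanLessThan_iff mult_nonneg_nonneg less_imp_le order_trans)
      have "r * (1 - r) \<le> 1 / m * c_const DIM('a) r p"
        using mM[of r] r m by (simp add: field_simps)
      then show "ennreal (r * (1 - r)) * energy W (r * p) \<le> ennreal (1 / m) * (ennreal (c_const DIM('a) r p) * energy W (r * p))"
        using m c0 by (subst ennreal_mult_mult) (auto intro!: mult_right_mono ennreal_leI)
      show "ennreal (c_const DIM('a) r p) * energy W (r * p) \<le> ennreal M * (ennreal (r * (1 - r)) * energy W (r * p))"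
        using mM[of r] r m \<open>0 \<le> r * (1 - r)\<close>
        by (subst ennreal_mult_mult) (auto intro!: mult_right_mono ennreal_leI)
    qed
    have conclude: "seminorm_sp s p u \<le> ennreal C * seminorm_sp S p u"
      if "seminorm_sp s p u = enn_root p X" "seminorm_sp S p u = enn_root p Y"
        "X \<le> ennreal k * Y" "0 < k" "k powr (1 / p) \<le> C" for X Y k
    proof -
      have "enn_root p X \<le> ennreal (k powr (1 / p)) * enn_root p Y"
        by (rule enn_root_le) (use that p in auto)
      also have "\<dots> \<le> ennreal C * enn_root p Y"
        using that by (intro mult_right_mono ennreal_leI) auto
      finally show ?thesis using that by simp
    qed
    have half: "U = ennreal (1 / 2) * (2 * U)"
      using ennreal_mult_mult[of "1 / 2" 2 U] by simp
    consider "s = S" | "s = 0" "0 < S" "S < 1" | "s = 0" "S = 1" | "0 < s" "s \<le> S" "S < 1" | "0 < s" "s < 1" "S = 1"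
      using s by linarith
    then show ?thesis
    proof cases
      case 1
      have "1 * seminorm_sp S p u \<le> ennreal C * seminorm_sp S p u"
        using C(1) by (intro mult_right_mono) (auto simp flip: ennreal_1)
      with 1 show ?thesis by simp
    next
      case 2
      have "2 * U * ennreal \<kappa> \<le> ennreal (2 * p * (2 * D) powr p * (S * (1 - S))) * energy W (S * p)"
        using energy_Poincare[OF W D(1) p(1) double far, of S] 2 by (simp add: \<kappa>)
      also have "\<dots> = ennreal (2 * p * (2 * D) powr p) * (ennreal (S * (1 - S)) * energy W (S * p))"
        using p 2 by (subst ennreal_mult_mult) auto
      also have "\<dots> \<le> ennreal (2 * p * (2 * D) powr p) * (ennreal (1 / m) * (ennreal (c_const DIM('a) S p) * energy W (S * p)))"
        using lower 2 by (intro mult_left_mono) auto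
      also have "\<dots> = ennreal (2 * p * (2 * D) powr p / m) * (ennreal (c_const DIM('a) S p) * energy W (S * p))"
        using p m by (subst ennreal_mult_mult) auto
      finally have "ennreal (1 / (2 * \<kappa>)) * (2 * U * ennreal \<kappa>) \<le> ennreal K1 * (ennreal (c_const DIM('a) S p) * energy W (S * p))"
        unfolding K1_def using p m \<kappa> by (subst ennreal_mult) (auto simp: mult.assoc intro!: mult_left_mono)
      moreover have "ennreal (1 / (2 * \<kappa>)) * (2 * U * ennreal \<kappa>) = U"
      proof -
        have "ennreal (1 / (2 * \<kappa>)) * ennreal \<kappa> = ennreal (1 / 2)"
          using \<kappa>(1) by (subst ennreal_mult[symmetric]) auto
        then show ?thesis by (metis half mult.assoc mult.commute)
      qed
      ultimately have "U \<le> ennreal K1 * (ennreal (c_const DIM('a) S p) * energy W (S * p))" by simp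
      with 2 K C show ?thesis
        by (intro conclude[where k = K1]) (auto simp: seminorm_0_eq[OF uv] seminorm_fractional_eq[OF uv v] U_def W_def)
    next
      case 3
      show ?thesis
      proof (rule seminorm_1_cases[of p u])
        assume "seminorm_sp 1 p u = \<infinity>"
        then show ?thesis using 3 C(1) by (simp add: ennreal_mult_top)
      next
        fix g assume g: "weak_gradient u g" "seminorm_sp 1 p u = enn_root p (\<integral>\<^sup>+x. ennreal (norm (g x) powr p) \<partial>lebesgue)"
        \<comment> \<open>A translation of length D gives W the value 2 U and is still controlled by
          the gradient bound; this is the Poincare inequality for order 1.\<close>
        obtain b :: 'a where "b \<in> Basis" using nonempty_Basis by blast
        then have b: "norm (D *\<^sub>R b) = D" using D by simp
        have "2 * U \<le> ennreal (D powr p) * (\<integral>\<^sup>+x. ennreal (norm (g x) powr p) \<partial>lebesgue)"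
          using lip[OF g(1), of "D *\<^sub>R b"] far[of "D *\<^sub>R b"] unfolding b by simp
        then have "ennreal (1 / 2) * (2 * U) \<le> ennreal (1 / 2) * (ennreal (D powr p) * (\<integral>\<^sup>+x. ennreal (norm (g x) powr p) \<partial>lebesgue))"
          by (intro mult_left_mono) auto
        also have "\<dots> = ennreal K2 * (\<integral>\<^sup>+x. ennreal (norm (g x) powr p) \<partial>lebesgue)"
          unfolding K2_def by (rule ennreal_mult_mult) auto
        finally have "U \<le> ennreal K2 * (\<integral>\<^sup>+x. ennreal (norm (g x) powr p) \<partial>lebesgue)"
          by (simp only: half[symmetric])
        with 3 K C g(2) show ?thesis
          by (intro conclude[where k = K2]) (auto simp: seminorm_0_eq[OF uv] U_def)
      qed
    next
      case 4
      let ?E = "ennreal (c_const DIM('a) S p) * energy W (S * p)"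
      have "ennreal (c_const DIM('a) s p) * energy W (s * p) \<le> ennreal M * (ennreal (s * (1 - s)) * energy W (s * p))"
        using upper 4 by auto
      also have "\<dots> \<le> ennreal M * (ennreal (3 * (2 * D) powr p / c) * (ennreal (S * (1 - S)) * energy W (S * p)))"
        unfolding c_def using energy_compare[OF W D(1) p(1) double far 4] by (intro mult_left_mono) auto
      also have "\<dots> \<le> ennreal M * (ennreal (3 * (2 * D) powr p / c) * (ennreal (1 / m) * ?E))"
        using lower[of S] 4 by (intro mult_left_mono) auto
      also have "\<dots> = ennreal K3 * ?E"
      proof -
        have nn: "0 \<le> 3 * (2 * D) powr p / c" "0 \<le> 1 / m" "0 \<le> M" "0 \<le> 3 * (2 * D) powr p / c * (1 / m)"
          using c m by auto
        show ?thesis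
          unfolding ennreal_mult_mult[OF nn(1,2)] ennreal_mult_mult[OF nn(3,4)] by (simp add: K3_def)
      qed
      finally have "ennreal (c_const DIM('a) s p) * energy W (s * p) \<le> ennreal K3 * ?E" .
      with 4 K C show ?thesis
        by (intro conclude[where k = K3]) (auto simp: seminorm_fractional_eq[OF uv v] W_def)
    next
      case 5
      show ?thesis
      proof (rule seminorm_1_cases[of p u])
        assume "seminorm_sp 1 p u = \<infinity>"
        then show ?thesis using 5 C(1) by (simp add: ennreal_mult_top)
      next
        fix g assume g: "weak_gradient u g" "seminorm_sp 1 p u = enn_root p (\<integral>\<^sup>+x. ennreal (norm (g x) powr p) \<partial>lebesgue)"
        let ?G = "\<integral>\<^sup>+x. ennreal (norm (g x) powr p) \<partial>lebesgue"
        have "ennreal (c_const DIM('a) s p) * energy W (s * p) \<le> ennreal M * (ennreal (s * (1 - s)) * energy W (s * p))"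
          using upper 5 by auto
        also have "\<dots> \<le> ennreal M * (ennreal (2 * (2 * D) powr p / (c * p)) * (?G * ennreal \<kappa>))"
          unfolding c_def \<kappa>(2)[symmetric] using energy_gradient_bound[OF W D(1) p(1) lip[OF g(1)] far 5(1,2)] by (intro mult_left_mono) auto
        also have "\<dots> = ennreal K4 * ?G"
        proof -
          have nn: "0 \<le> 2 * (2 * D) powr p / (c * p)" "0 \<le> \<kappa>" "0 \<le> M" "0 \<le> 2 * (2 * D) powr p / (c * p) * \<kappa>"
            using c m p \<kappa> by auto
          show ?thesis
            unfolding mult.commute[of ?G] ennreal_mult_mult[OF nn(1,2)] ennreal_mult_mult[OF nn(3,4)] by (simp only: K4_def)
        qed
        finally have "ennreal (c_const DIM('a) s p) * energy W (s * p) \<le> ennreal K4 * ?G" .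
        with 5 K C g(2) show ?thesis
          by (intro conclude[where k = K4]) (auto simp: seminorm_fractional_eq[OF uv v] W_def)
      qed
    qed
  qed
  show ?thesis
    using main C(1) by (intro exI[of _ C]) auto
qed

end
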